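(* Let $n \geq 2$ be an integer. The degree of the $n$-th cycle polynomial $\Gamma_n'$ is given by $$\deg(\Gamma_n') = \frac{n}{2}\binom{n-1}{\lfloor \frac{1}{2}(n-1)\rfloor}.$$
   Context: Let $A_n \in \mathbb{Z}^{(n-1)\times n}$ be the matrix $A_n = (\,\mathrm{id}_{n-1} \mid -\mathbf{1}\,)$ whose first $n-1$ columns form the identity matrix and whose last column has all entries equal to $-1$. Let $\operatorname{Row}(A_n) \subseteq \mathbb{C}^n$ be the $\mathbb{C}$-linear span of its rows, and let $\mathcal{C}_{A_n} = \{(\cos x_1,\dots,\cos x_n) : x \in \operatorname{Row}(A_n)\} \subseteq \mathbb{C}^n$, which is an irreducible Zariski closed hypersurface in $\mathbb{C}^n$. The $n$-th cycle polynomial $\Gamma_n' \in \mathbb{C}[x_1,\dots,x_n]$ is the defining polynomial of this hypersurface, i.e. the generator (unique up to a nonzero scalar) of its prime ideal; $\deg$ denotes total degree. *)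

theory Defs
  imports
    Complex_Main
    "Jordan_Normal_Form.VS_Connect"
    "HOL-Library.Poly_Mapping"
begin

text \<open>Polynomials in countably many variables over \<^typ>\<open>complex\<close>: a monomial maps each variable
  to its exponent, a polynomial maps each monomial to its coefficient. The ring structure
  (convolution product) is the one of \<^theory>\<open>HOL-Library.Poly_Mapping\<close>.\<close>

type_synonym cpoly = "(nat \<Rightarrow>\<^sub>0 nat) \<Rightarrow>\<^sub>0 complex"

text \<open>The variables \<open>x\<^sub>1, \<dots>, x\<^sub>n\<close> are numbered \<open>0, \<dots>, n - 1\<close>, in accordance with the indices of
  vectors in \<^term>\<open>carrier_vec n\<close>.\<close>

definition polys_in :: "nat \<Rightarrow> cpoly set" where
  "polys_in n = {p. \<forall>m \<in> Poly_Mapping.keys p. Poly_Mapping.keys m \<subseteq> {..<n}}"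

definition poly_eval :: "cpoly \<Rightarrow> complex vec \<Rightarrow> complex" where
  "poly_eval p v =
     (\<Sum>m \<in> Poly_Mapping.keys p.
        Poly_Mapping.lookup p m * (\<Prod>i \<in> Poly_Mapping.keys m. (v $ i) ^ Poly_Mapping.lookup m i))"

text \<open>The zero polynomial gets total degree \<open>0\<close>.\<close>

definition total_degree :: "cpoly \<Rightarrow> nat" where
  "total_degree p =
     Max (insert 0 ((\<lambda>m. \<Sum>i \<in> Poly_Mapping.keys m. Poly_Mapping.lookup m i) ` Poly_Mapping.keys p))"

definition vanishing_ideal :: "nat \<Rightarrow> complex vec set \<Rightarrow> cpoly set" where
  "vanishing_ideal n S = {p \<in> polys_in n. \<forall>v \<in> S. poly_eval p v = 0}"

definition cycle_matrix :: "nat \<Rightarrow> int mat" where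
  "cycle_matrix n = mat (n - 1) n (\<lambda>(i, j). if j = n - 1 then - 1 else if i = j then 1 else 0)"

definition Row :: "int mat \<Rightarrow> complex vec set" where
  "Row A = vec_space.row_space (dim_col A) (map_mat of_int A)"

definition cosine_variety :: "int mat \<Rightarrow> complex vec set" where
  "cosine_variety A = map_vec cos ` Row A"

text \<open>The cycle polynomial is determined only up to a nonzero scalar, hence a predicate:
  \<open>\<Gamma>\<close> generates the ideal of all polynomials in \<open>n\<close> variables vanishing on the variety.\<close>

definition is_cycle_polynomial :: "nat \<Rightarrow> cpoly \<Rightarrow> bool" where
  "is_cycle_polynomial n \<Gamma> \<longleftrightarrow>
     \<Gamma> \<in> polys_in n \<and>
     vanishing_ideal n (cosine_variety (cycle_matrix n)) = {q * \<Gamma> | q. q \<in> polys_in n}"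

end

theory Submission
  imports Defs "HOL-Analysis.Complex_Transcendental"
begin

text \<open>Write \<open>n = m + 2\<close>. The product of \<open>c\<^sub>n - cos (\<plusminus>x\<^sub>1 \<plusminus> \<dots> \<plusminus> x\<^bsub>n-1\<^esub>)\<close> over all choices of signs with \<open>x\<^sub>1\<close>
  taken positively is invariant under \<open>x\<^sub>i \<mapsto> -x\<^sub>i\<close>, hence a polynomial \<open>F\<close> in \<open>c\<^sub>i = cos x\<^sub>i\<close>, monic of
  degree \<open>2 ^ m\<close> in \<open>c\<^sub>n\<close>. For generic \<open>c\<^sub>1, \<dots>, c\<^bsub>n-1\<^esub>\<close> its \<open>2 ^ m\<close> roots are distinct and lie on the
  variety, so division with remainder by \<open>F\<close> shows that \<open>F\<close> divides every polynomial vanishing there,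
  and \<open>F\<close> is the cycle polynomial up to a scalar. Its degree is the order of growth along
  \<open>exp (\<i> x\<^sub>i) = a\<^sub>i / t\<close> as \<open>t \<rightarrow> 0\<close> with generic \<open>a\<close>: a factor whose signs add up to \<open>k\<close> grows like
  \<open>t\<close> to the power \<open>- max 1 \<bar>k\<bar>\<close>, and these exponents add up to the binomial expression.\<close>

subsection \<open>Polynomials and polynomial functions\<close>

definition meval :: "(nat \<Rightarrow>\<^sub>0 nat) \<Rightarrow> (nat \<Rightarrow> complex) \<Rightarrow> complex" where
  "meval m c = (\<Prod>i \<in> Poly_Mapping.keys m. c i ^ Poly_Mapping.lookup m i)"

text \<open>Points are total functions, so that coordinates can be replaced by
  \<open>c(i := z)\<close> and no dimension has to be carried along.\<close>

definition peval :: "cpoly \<Rightarrow> (nat \<Rightarrow> complex) \<Rightarrow> complex" where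
  "peval p c = (\<Sum>m \<in> Poly_Mapping.keys p. Poly_Mapping.lookup p m * meval m c)"

lemma poly_eval_eq_peval: "poly_eval p v = peval p (vec_index v)"
  by (simp add: poly_eval_def peval_def meval_def)

lemma meval_superset:
  "finite K \<Longrightarrow> Poly_Mapping.keys m \<subseteq> K \<Longrightarrow> meval m c = (\<Prod>i \<in> K. c i ^ Poly_Mapping.lookup m i)"
  unfolding meval_def by (rule prod.mono_neutral_left) (auto simp: in_keys_iff)

lemma meval_add: "meval (m + l) c = meval m c * meval l c"
proof -
  let ?K = "Poly_Mapping.keys m \<union> Poly_Mapping.keys l"
  have "meval (m + l) c = (\<Prod>i \<in> ?K. c i ^ Poly_Mapping.lookup (m + l) i)"
    by (rule meval_superset) (auto simp: keys_add)
  then show ?thesis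
    by (simp add: meval_superset[of ?K] lookup_add power_add prod.distrib)
qed

lemma peval_superset:
  "finite K \<Longrightarrow> Poly_Mapping.keys p \<subseteq> K \<Longrightarrow> peval p c = (\<Sum>m \<in> K. Poly_Mapping.lookup p m * meval m c)"
  unfolding peval_def by (rule sum.mono_neutral_left) (auto simp: in_keys_iff)

lemma peval_add: "peval (p + q) c = peval p c + peval q c"
proof -
  let ?K = "Poly_Mapping.keys p \<union> Poly_Mapping.keys q"
  have "peval (p + q) c = (\<Sum>m \<in> ?K. Poly_Mapping.lookup (p + q) m * meval m c)"
    by (rule peval_superset) (auto simp: keys_add)
  then show ?thesis
    by (simp add: peval_superset[of ?K] lookup_add algebra_simps sum.distrib)
qed

lemma peval_zero: "peval 0 c = 0"
  by (simp add: peval_def)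

lemma peval_sum: "peval (sum f A) c = (\<Sum>a \<in> A. peval (f a) c)"
  by (induction A rule: infinite_finite_induct) (auto simp: peval_add peval_zero)

lemma peval_single: "peval (Poly_Mapping.single m a) c = a * meval m c"
  by (simp add: peval_def)

lemma cpoly_sum_singles:
  "p = (\<Sum>m \<in> Poly_Mapping.keys p. Poly_Mapping.single m (Poly_Mapping.lookup p m))"
  by (rule poly_mapping_eqI) (auto simp: lookup_sum lookup_single when_def in_keys_iff)

lemma peval_mult: "peval (p * q) c = peval p c * peval q c"
proof -
  have "p * q = (\<Sum>m \<in> Poly_Mapping.keys p. \<Sum>l \<in> Poly_Mapping.keys q.
      Poly_Mapping.single (m + l) (Poly_Mapping.lookup p m * Poly_Mapping.lookup q l))"
    by (subst cpoly_sum_singles[of p], subst cpoly_sum_singles[of q])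
      (simp add: sum_product mult_single)
  then show ?thesis
    by (simp add: peval_sum peval_single meval_add) (simp add: peval_def sum_product algebra_simps)
qed

lemma peval_cong:
  assumes "p \<in> polys_in n" "\<And>i. i < n \<Longrightarrow> c i = d i"
  shows "peval p c = peval p d"
proof -
  have "c i = d i" if "m \<in> Poly_Mapping.keys p" "i \<in> Poly_Mapping.keys m" for m i
    using assms that unfolding polys_in_def by blast
  then show ?thesis by (simp add: peval_def meval_def)
qed

lemma polys_in_add: "p \<in> polys_in n \<Longrightarrow> q \<in> polys_in n \<Longrightarrow> p + q \<in> polys_in n"
  using keys_add[of p q] by (auto simp: polys_in_def)

lemma polys_in_mult:
  assumes "p \<in> polys_in n" "q \<in> polys_in n"
  shows "p * q \<in> polys_in n"
  unfolding polys_in_def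
proof (intro CollectI ballI)
  fix m assume "m \<in> Poly_Mapping.keys (p * q)"
  then obtain k l where "m = k + l" "k \<in> Poly_Mapping.keys p" "l \<in> Poly_Mapping.keys q"
    using keys_mult[of p q] by blast
  then show "Poly_Mapping.keys m \<subseteq> {..<n}"
    using assms keys_add[of k l] unfolding polys_in_def by blast
qed

text \<open>Closure under products with a single coordinate is assumed instead of closure under arbitrary
  products because it makes division with remainder by a monic polynomial a plain induction.\<close>

inductive polyfun :: "nat \<Rightarrow> ((nat \<Rightarrow> complex) \<Rightarrow> complex) \<Rightarrow> bool" for n where
  const: "polyfun n (\<lambda>c. a)"
| add: "polyfun n f \<Longrightarrow> polyfun n g \<Longrightarrow> polyfun n (\<lambda>c. f c + g c)"
| coord_mult: "i < n \<Longrightarrow> polyfun n f \<Longrightarrow> polyfun n (\<lambda>c. c i * f c)"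

lemma polyfun_mult:
  assumes "polyfun n f" "polyfun n g"
  shows "polyfun n (\<lambda>c. f c * g c)"
  using assms(1)
proof induction
  case (const a)
  from assms(2) show ?case
  proof induction
    case (const b)
    show ?case by (rule polyfun.const)
  next
    case (add f g)
    then show ?case by (simp add: distrib_left polyfun.add)
  next
    case (coord_mult i f)
    then show ?case
      using polyfun.coord_mult[of i n "\<lambda>c. a * f c"] by (simp add: mult.left_commute)
  qed
next
  case (add f h)
  then show ?case by (simp add: distrib_right polyfun.add)
next
  case (coord_mult i f)
  then show ?case using polyfun.coord_mult[of i n "\<lambda>c. f c * g c"] by (simp add: mult.assoc)
qed

lemma polyfun_coord: "i < n \<Longrightarrow> polyfun n (\<lambda>c. c i)"
  using polyfun.coord_mult[OF _ polyfun.const[of n 1]] by simp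

lemma polyfun_diff: "polyfun n f \<Longrightarrow> polyfun n g \<Longrightarrow> polyfun n (\<lambda>c. f c - g c)"
  using polyfun.add[OF _ polyfun_mult[OF polyfun.const[of n "-1"]]] by fastforce

lemma polyfun_power: "polyfun n f \<Longrightarrow> polyfun n (\<lambda>c. f c ^ k)"
  by (induction k) (auto intro: polyfun_mult polyfun.const)

lemma polyfun_sum: "(\<And>a. a \<in> A \<Longrightarrow> polyfun n (f a)) \<Longrightarrow> polyfun n (\<lambda>c. \<Sum>a \<in> A. f a c)"
  by (induction A rule: infinite_finite_induct) (auto intro: polyfun.intros)

lemma polyfun_prod: "(\<And>a. a \<in> A \<Longrightarrow> polyfun n (f a)) \<Longrightarrow> polyfun n (\<lambda>c. \<Prod>a \<in> A. f a c)"
  by (induction A rule: infinite_finite_induct) (auto intro: polyfun.intros polyfun_mult)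

lemma polyfun_mono: "polyfun n f \<Longrightarrow> n \<le> n' \<Longrightarrow> polyfun n' f"
  by (induction rule: polyfun.induct) (auto intro: polyfun.intros)

lemma polyfun_cong:
  assumes "polyfun n f" "\<And>i. i < n \<Longrightarrow> c i = d i"
  shows "f c = f d"
  using assms by (induction rule: polyfun.induct) auto

text \<open>Constructions are carried out on functions; this returns to \<open>cpoly\<close>, in
  which the vanishing ideal is phrased.\<close>

lemma polyfun_peval:
  assumes "polyfun n f"
  obtains p where "p \<in> polys_in n" "peval p = f"
  using assms
proof (induction arbitrary: thesis)
  case (const a)
  show ?case
    by (rule const[of "Poly_Mapping.single 0 a"])
      (auto simp: polys_in_def peval_single meval_def fun_eq_iff)
next
  case (add f g)
  then obtain p q where "p \<in> polys_in n" "peval p = f" "q \<in> polys_in n" "peval q = g"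
    by metis
  then show ?case
    by (intro add.prems[of "p + q"] polys_in_add) (auto simp: peval_add fun_eq_iff)
next
  case (coord_mult i f)
  then obtain p where "p \<in> polys_in n" "peval p = f"
    by metis
  moreover have "Poly_Mapping.single (Poly_Mapping.single i 1) 1 \<in> polys_in n"
    using coord_mult.hyps by (auto simp: polys_in_def)
  ultimately show ?case
    by (intro coord_mult.prems[of "Poly_Mapping.single (Poly_Mapping.single i 1) 1 * p"] polys_in_mult)
      (auto simp: peval_mult peval_single meval_def fun_eq_iff)
qed

section \<open>Non-vanishing of polynomial functions\<close>

lemma polyfun_line:
  assumes "polyfun n f"
  obtains p where "\<And>t. f (\<lambda>i. u i + t * w i) = poly p t"
  using assms
proof (induction arbitrary: thesis)
  case (const a)
  show ?case by (rule const[of "[:a:]"]) auto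
next
  case (add f g)
  from add.IH obtain p q where "\<And>t. f (\<lambda>i. u i + t * w i) = poly p t"
    "\<And>t. g (\<lambda>i. u i + t * w i) = poly q t" by metis
  then show ?case by (intro add.prems[of "p + q"]) auto
next
  case (coord_mult i f)
  from coord_mult.IH obtain p where "\<And>t. f (\<lambda>i. u i + t * w i) = poly p t" by metis
  then show ?case by (intro coord_mult.prems[of "[:u i, w i:] * p"]) (auto simp: algebra_simps)
qed

text \<open>On the line from \<open>u\<close> to \<open>v\<close> both functions restrict to nonzero
  univariate polynomials, whose product has only finitely many roots. This replaces the absence of
  zero divisors.\<close>

lemma polyfun_common_nonzero:
  assumes "polyfun n f" "f u \<noteq> 0" "polyfun n g" "g v \<noteq> 0"
  obtains c where "f c * g c \<noteq> 0"
proof -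
  let ?l = "\<lambda>t i. u i + t * (v i - u i)"
  obtain p q where pq: "\<And>t. f (?l t) = poly p t" "\<And>t. g (?l t) = poly q t"
    using polyfun_line[OF assms(1), of u "\<lambda>i. v i - u i"]
      polyfun_line[OF assms(3), of u "\<lambda>i. v i - u i"] by metis
  have "poly p 0 \<noteq> 0" "poly q 1 \<noteq> 0"
    using assms(2,4) pq(1)[of 0] pq(2)[of 1] by auto
  then have "p * q \<noteq> 0" by auto
  then have "finite {t. poly (p * q) t = 0}" by (rule poly_roots_finite)
  then obtain t where "poly (p * q) t \<noteq> 0"
    using infinite_UNIV_char_0 ex_new_if_finite by blast
  then show thesis by (intro that[of "?l t"]) (simp add: pq)
qed

text \<open>Starting from \<open>u\<close>, the coordinates are moved into the sets
  \<open>S i\<close> one at a time: in each coordinate direction only finitely many values have to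
  be avoided.\<close>

lemma polyfun_nonzero_on_product:
  assumes "polyfun n f" "f u \<noteq> 0" "\<And>i. i < n \<Longrightarrow> infinite (S i)"
  obtains v where "\<And>i. i < n \<Longrightarrow> v i \<in> S i" "f v \<noteq> 0"
proof -
  have "k \<le> n \<Longrightarrow> \<exists>v. (\<forall>i<k. v i \<in> S i) \<and> f v \<noteq> 0" for k
  proof (induction k)
    case 0
    then show ?case using assms(2) by auto
  next
    case (Suc k)
    then obtain v where v: "\<forall>i<k. v i \<in> S i" "f v \<noteq> 0" by auto
    let ?l = "\<lambda>t i. v i + t * (if i = k then 1 else 0)"
    obtain p where p: "\<And>t. f (?l t) = poly p t"
      using polyfun_line[OF assms(1), of v "\<lambda>i. if i = k then 1 else 0"] by metis
    have "poly p 0 \<noteq> 0" using v(2) p[of 0] by simp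
    then have "finite {t. poly p t = 0}" by (intro poly_roots_finite) auto
    then have "finite ((\<lambda>t. v k + t) ` {t. poly p t = 0})" by simp
    moreover have "infinite (S k)" using assms(3) Suc.prems by simp
    ultimately obtain s where "s \<in> S k" "s \<notin> (\<lambda>t. v k + t) ` {t. poly p t = 0}"
      by (metis finite_subset subsetI)
    then have s: "s \<in> S k" "poly p (s - v k) \<noteq> 0" by (auto simp: image_iff)
    show ?case
      by (intro exI[of _ "?l (s - v k)"]) (use s v p in \<open>auto simp: less_Suc_eq\<close>)
  qed
  then show thesis using that by blast
qed

section \<open>Kronecker substitution\<close>

lemma digits_unique:
  fixes f g :: "nat \<Rightarrow> nat"
  assumes "\<And>i. i < n \<Longrightarrow> f i < B" "\<And>i. i < n \<Longrightarrow> g i < B"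
    and "(\<Sum>i<n. f i * B ^ i) = (\<Sum>i<n. g i * B ^ i)" "i < n"
  shows "f i = g i"
  using assms
proof (induction n arbitrary: f g i)
  case (Suc n)
  have shift: "(\<Sum>i<Suc n. h i * B ^ i) = h 0 + B * (\<Sum>i<n. h (Suc i) * B ^ i)" for h :: "nat \<Rightarrow> nat"
    by (subst sum.lessThan_Suc_shift) (simp add: sum_distrib_left algebra_simps)
  have eq: "f 0 + B * (\<Sum>i<n. f (Suc i) * B ^ i) = g 0 + B * (\<Sum>i<n. g (Suc i) * B ^ i)"
    using Suc.prems(3) unfolding shift .
  have lt: "f 0 < B" "g 0 < B" using Suc.prems by auto
  have "f 0 = g 0" using arg_cong[OF eq, of "\<lambda>x. x mod B"] lt by simp
  moreover have "(\<Sum>i<n. f (Suc i) * B ^ i) = (\<Sum>i<n. g (Suc i) * B ^ i)"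
    using eq calculation lt by simp
  then have "j < n \<Longrightarrow> f (Suc j) = g (Suc j)" for j
    using Suc.IH[of "f \<circ> Suc" "g \<circ> Suc" j] Suc.prems(1,2) by simp
  ultimately show ?case using Suc.prems(4) by (cases i) auto
qed auto

text \<open>Kronecker substitution: \<open>x\<^sub>i \<mapsto> t\<^bsup>B^i\<^esup>\<close> sends distinct monomials to distinct powers of \<open>t\<close>.\<close>

lemma peval_nonzero:
  assumes "p \<in> polys_in n" "p \<noteq> 0"
  obtains c where "peval p c \<noteq> 0"
proof -
  let ?K = "Poly_Mapping.keys p"
  \<comment> \<open>\<open>B\<close> exceeds every exponent in \<open>p\<close>, so the exponents of
    a monomial are the base \<open>B\<close> digits of \<open>e m\<close>.\<close>
  define B where "B = Suc (\<Sum>m \<in> ?K. \<Sum>i<n. Poly_Mapping.lookup m i)"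
  define e where "e m = (\<Sum>i<n. Poly_Mapping.lookup m i * B ^ i)" for m :: "nat \<Rightarrow>\<^sub>0 nat"
  have lt: "Poly_Mapping.lookup m i < B" if "m \<in> ?K" "i < n" for m i
  proof -
    have "Poly_Mapping.lookup m i \<le> (\<Sum>i<n. Poly_Mapping.lookup m i)"
      using that by (intro member_le_sum) auto
    also have "\<dots> \<le> (\<Sum>m \<in> ?K. \<Sum>i<n. Poly_Mapping.lookup m i)"
      using that by (intro member_le_sum) auto
    finally show ?thesis by (simp add: B_def)
  qed
  have inj: "m = l" if "m \<in> ?K" "l \<in> ?K" "e m = e l" for m l
  proof (rule poly_mapping_eqI)
    fix i
    show "Poly_Mapping.lookup m i = Poly_Mapping.lookup l i"
    proof (cases "i < n")
      case True
      then show ?thesis using digits_unique[of n "Poly_Mapping.lookup m" B "Poly_Mapping.lookup l" i]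
        that lt by (auto simp: e_def)
    next
      case False
      then have "i \<notin> Poly_Mapping.keys m" "i \<notin> Poly_Mapping.keys l"
        using assms(1) that by (auto simp: polys_in_def)
      then show ?thesis by (simp add: in_keys_iff)
    qed
  qed
  define P where "P = (\<Sum>m \<in> ?K. monom (Poly_Mapping.lookup p m) (e m))"
  have ev: "peval p (\<lambda>i. t ^ (B ^ i)) = poly P t" for t
  proof -
    have "meval m (\<lambda>i. t ^ (B ^ i)) = t ^ e m" if "m \<in> ?K" for m
      using that assms(1) unfolding e_def
      by (subst meval_superset[of "{..<n}"])
        (auto simp: polys_in_def power_sum mult.commute simp flip: power_mult)
    then show ?thesis by (simp add: peval_def P_def poly_sum poly_monom)
  qed
  obtain m where m: "m \<in> ?K" using assms(2) by (meson ex_in_conv keys_eq_empty)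
  have "coeff P (e m) = (\<Sum>l \<in> ?K. if l = m then Poly_Mapping.lookup p m else 0)"
    unfolding P_def coeff_sum by (rule sum.cong) (use inj m in auto)
  also have "\<dots> \<noteq> 0" using m by (simp add: in_keys_iff)
  finally have "P \<noteq> 0" by auto
  then have "finite {t. poly P t = 0}" by (rule poly_roots_finite)
  then obtain t where "poly P t \<noteq> 0"
    using infinite_UNIV_char_0 ex_new_if_finite by blast
  then show thesis by (intro that[of "\<lambda>i. t ^ (B ^ i)"]) (simp add: ev)
qed

section \<open>Expansion and division in the last variable\<close>

text \<open>The expansion is claimed for every upper limit \<open>e\<close> from \<open>d\<close>
  on, so that two expansions can be added by passing to the larger of their bounds.\<close>

lemma polyfun_expand:
  assumes "polyfun (Suc n) f"
  obtains d g where "\<And>k. polyfun n (g k)" "\<And>c e. d \<le> e \<Longrightarrow> f c = (\<Sum>k\<le>e. g k c * c n ^ k)"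
  using assms
proof (induction arbitrary: thesis)
  case (const a)
  show ?case
    by (rule const[of "\<lambda>k c. if k = 0 then a else 0" 0])
      (auto intro: polyfun.const simp: if_distrib[of "\<lambda>x. x * _"] cong: if_cong)
next
  case (add f1 f2)
  from add.IH(1) obtain g1 d1 where "\<And>k. polyfun n (g1 k)"
    "\<And>c e. d1 \<le> e \<Longrightarrow> f1 c = (\<Sum>k\<le>e. g1 k c * c n ^ k)" by blast
  moreover from add.IH(2) obtain g2 d2 where "\<And>k. polyfun n (g2 k)"
    "\<And>c e. d2 \<le> e \<Longrightarrow> f2 c = (\<Sum>k\<le>e. g2 k c * c n ^ k)" by blast
  ultimately show ?case
    by (intro add.prems[of "\<lambda>k c. g1 k c + g2 k c" "max d1 d2"])
      (auto intro: polyfun.add simp: distrib_right sum.distrib)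
next
  case (coord_mult i f)
  from coord_mult.IH obtain g d where g: "\<And>k. polyfun n (g k)"
    "\<And>c e. d \<le> e \<Longrightarrow> f c = (\<Sum>k\<le>e. g k c * c n ^ k)" by blast
  show ?case
  proof (cases "i = n")
    case True
    show ?thesis
    proof (rule coord_mult.prems[of "\<lambda>k. case k of 0 \<Rightarrow> (\<lambda>c. 0) | Suc k \<Rightarrow> g k" "Suc d"])
      show "polyfun n (case k of 0 \<Rightarrow> (\<lambda>c. 0) | Suc k \<Rightarrow> g k)" for k
        by (cases k) (auto intro: polyfun.const g(1))
      show "c i * f c = (\<Sum>k\<le>e. (case k of 0 \<Rightarrow> (\<lambda>c. 0) | Suc k \<Rightarrow> g k) c * c n ^ k)"
        if "Suc d \<le> e" for c e
      proof -
        from that obtain e' where e': "e = Suc e'" "d \<le> e'" by (cases e) auto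
        show ?thesis
          unfolding e'(1) by (subst sum.atMost_Suc_shift)
            (simp add: True g(2)[OF e'(2)] sum_distrib_left algebra_simps)
      qed
    qed
  next
    case False
    then have "i < n" using coord_mult.hyps by simp
    then show ?thesis
      by (intro coord_mult.prems[of "\<lambda>k c. c i * g k c" d])
        (auto intro: polyfun.coord_mult simp: g sum_distrib_left algebra_simps)
  qed
qed

text \<open>\<open>P\<close> is monic in the last coordinate. Only multiplication by that coordinate
  can raise the degree of a remainder to \<open>N\<close>; subtracting \<open>r M\<close> times
  \<open>P\<close> then removes the top term.\<close>

lemma polyfun_division:
  assumes "polyfun (Suc n) f" "\<And>k. polyfun n (p k)" "N > 0"
    and P: "\<And>c. P c = c n ^ N + (\<Sum>k<N. p k c * c n ^ k)"
  obtains q r where "polyfun (Suc n) q" "\<And>k. polyfun n (r k)"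
    "\<And>c. f c = q c * P c + (\<Sum>k<N. r k c * c n ^ k)"
  using assms(1)
proof (induction arbitrary: thesis)
  case (const a)
  show ?case
    by (rule const[of "\<lambda>c. 0" "\<lambda>k c. if k = 0 then a else 0"])
      (use \<open>N > 0\<close> in \<open>auto intro: polyfun.const simp: if_distrib[of "\<lambda>x. x * _"] cong: if_cong\<close>)
next
  case (add f1 f2)
  from add.IH(1) obtain q1 r1 where "polyfun (Suc n) q1" "\<And>k. polyfun n (r1 k)"
    "\<And>c. f1 c = q1 c * P c + (\<Sum>k<N. r1 k c * c n ^ k)" by blast
  moreover from add.IH(2) obtain q2 r2 where "polyfun (Suc n) q2" "\<And>k. polyfun n (r2 k)"
    "\<And>c. f2 c = q2 c * P c + (\<Sum>k<N. r2 k c * c n ^ k)" by blast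
  ultimately show ?case
    by (intro add.prems[of "\<lambda>c. q1 c + q2 c" "\<lambda>k c. r1 k c + r2 k c"])
      (auto intro: polyfun.add simp: distrib_right sum.distrib)
next
  case (coord_mult i f)
  from coord_mult.IH obtain q r where qr: "polyfun (Suc n) q" "\<And>k. polyfun n (r k)"
    "\<And>c. f c = q c * P c + (\<Sum>k<N. r k c * c n ^ k)" by blast
  show ?case
  proof (cases "i = n")
    case True
    obtain M where M: "N = Suc M" using \<open>N > 0\<close> by (cases N) auto
    let ?s = "\<lambda>k c. case k of 0 \<Rightarrow> 0 | Suc k \<Rightarrow> r k c"
    \<comment> \<open>Here \<open>Z + T\<close> is \<open>P\<close> split into leading and lower
      terms, \<open>S\<close> is the old remainder, and \<open>U + R * Z\<close> is that remainder
      multiplied by the last coordinate.\<close>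
    have rearrange: "z * (q * (Z + T) + S) = (z * q + R) * (Z + T) + (U - R * T)"
      if "U + R * Z = z * S" for z q Z T S R U :: complex
    proof -
      have "z * (q * (Z + T) + S) = z * q * (Z + T) + (U + R * Z)"
        unfolding that by (simp add: algebra_simps)
      then show ?thesis by (simp add: algebra_simps)
    qed
    have s: "polyfun n (?s k)" for k
      by (cases k) (auto intro: polyfun.const qr)
    show ?thesis
    proof (rule coord_mult.prems[of "\<lambda>c. c n * q c + r M c" "\<lambda>k c. ?s k c - r M c * p k c"])
      show "polyfun (Suc n) (\<lambda>c. c n * q c + r M c)"
        by (intro polyfun.add polyfun.coord_mult qr polyfun_mono[of n]) auto
      show "polyfun n (\<lambda>c. ?s k c - r M c * p k c)" for k
        by (intro polyfun_diff polyfun_mult s qr assms)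
      fix c
      have "(\<Sum>k<N. ?s k c * c n ^ k) + r M c * c n ^ N = c n * (\<Sum>k<N. r k c * c n ^ k)"
        unfolding M by (subst sum.lessThan_Suc_shift)
          (simp add: sum_distrib_left algebra_simps)
      then show "c i * f c = (c n * q c + r M c) * P c + (\<Sum>k<N. (?s k c - r M c * p k c) * c n ^ k)"
        unfolding True qr(3) P left_diff_distrib sum_subtractf mult.assoc sum_distrib_left[symmetric]
        by (rule rearrange)
    qed
  next
    case False
    then have "i < n" using coord_mult.hyps by simp
    then show ?thesis
      by (intro coord_mult.prems[of "\<lambda>c. c i * q c" "\<lambda>k c. c i * r k c"])
        (auto intro: polyfun.coord_mult qr simp: qr(3) sum_distrib_left algebra_simps)
  qed
qed

section \<open>Symmetric functions of two roots\<close>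

text \<open>With \<open>s\<close> the sum and \<open>p\<close> the product of the roots, power sums
  satisfy Newton's recurrence \<open>w (j + 2) = s * w (j + 1) - p * w j\<close>.\<close>

lemma polyfun_power_sums:
  assumes "polyfun n s" "polyfun n p"
  shows "\<exists>w. polyfun n w \<and> (\<forall>c a b. a + b = s c \<longrightarrow> a * b = p c \<longrightarrow> w c = a ^ j + b ^ j)"
proof (induction j rule: less_induct)
  case (less j)
    consider "j = 0" | "j = 1" | i where "j = Suc (Suc i)"
      by (metis One_nat_def not0_implies_Suc)
    then show ?case
    proof cases
      case 1
      then show ?thesis by (intro exI[of _ "\<lambda>c. 2"]) (auto intro: polyfun.const)
    next
      case 2
      then show ?thesis by (intro exI[of _ s]) (auto intro: assms)
    next
      case 3
      then obtain v w where v: "polyfun n v"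
          "\<And>c a b. a + b = s c \<Longrightarrow> a * b = p c \<Longrightarrow> v c = a ^ i + b ^ i"
        and w: "polyfun n w"
          "\<And>c a b. a + b = s c \<Longrightarrow> a * b = p c \<Longrightarrow> w c = a ^ Suc i + b ^ Suc i"
        using less[of i] less[of "Suc i"] by auto
      have "polyfun n (\<lambda>c. s c * w c - p c * v c)"
        by (intro polyfun_diff polyfun_mult assms v w)
      moreover have "s c * w c - p c * v c = a ^ j + b ^ j" if ab: "a + b = s c" "a * b = p c" for c a b
        unfolding v(2)[OF ab] w(2)[OF ab] unfolding ab[symmetric] by (simp add: 3 algebra_simps)
      ultimately show ?thesis by blast
    qed
qed

text \<open>The fundamental theorem on symmetric polynomials in two variables: the product is the norm
  of \<open>\<Sum>k\<le>d. g k * X ^ k\<close> modulo \<open>X\<^sup>2 - s * X + p\<close>.\<close>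

lemma polyfun_norm:
  assumes "\<And>k. polyfun n (g k)" "polyfun n s" "polyfun n p"
  obtains F where "polyfun n F"
    "\<And>c a b. a + b = s c \<Longrightarrow> a * b = p c \<Longrightarrow>
      F c = (\<Sum>k\<le>d. g k c * a ^ k) * (\<Sum>k\<le>d. g k c * b ^ k)"
proof -
  have "\<forall>j. \<exists>w. polyfun n w \<and>
      (\<forall>c a b. a + b = s c \<longrightarrow> a * b = p c \<longrightarrow> w c = a ^ j + b ^ j)"
    by (intro allI polyfun_power_sums assms)
  from choice[OF this] obtain w where "\<forall>j. polyfun n (w j) \<and>
      (\<forall>c a b. a + b = s c \<longrightarrow> a * b = p c \<longrightarrow> w j c = a ^ j + b ^ j)" ..
  then have w: "\<And>j. polyfun n (w j)"
    "\<And>j c a b. a + b = s c \<Longrightarrow> a * b = p c \<Longrightarrow> w j c = a ^ j + b ^ j"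
    by simp_all
  \<comment> \<open>This equals \<open>a ^ k * b ^ l + a ^ l * b ^ k\<close>: a power of
    \<open>a * b\<close> is split off and a power sum remains.\<close>
  let ?W = "\<lambda>k l c. p c ^ min k l * w (max k l - min k l) c"
  have W: "?W k l c = a ^ k * b ^ l + a ^ l * b ^ k"
    if "a + b = s c" "a * b = p c" for c a b and k l :: nat
  proof -
    have *: "(a * b) ^ k * (a ^ (l - k) + b ^ (l - k)) = a ^ k * b ^ l + a ^ l * b ^ k"
      if kl: "k \<le> l" for k l
    proof -
      obtain i where "l = k + i" using le_Suc_ex[OF kl] ..
      moreover have "(a * b) ^ k * (a ^ i + b ^ i) = a ^ k * b ^ (k + i) + a ^ (k + i) * b ^ k"
        unfolding power_add power_mult_distrib distrib_left by (simp only: ac_simps)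
      ultimately show ?thesis by simp
    qed
    show ?thesis
      using *[of k l] *[of l k] unfolding w(2)[OF that] that(2)[symmetric]
      by (cases "k \<le> l") (auto simp: min_def max_def)
  qed
  \<comment> \<open>The symmetrised double sum counts the product of the two sums twice, hence the
    factor \<open>1 / 2\<close>.\<close>
  show thesis
  proof (rule that[of "\<lambda>c. (1 / 2) * (\<Sum>k\<le>d. \<Sum>l\<le>d. g k c * g l c * ?W k l c)"])
    show "polyfun n (\<lambda>c. (1 / 2) * (\<Sum>k\<le>d. \<Sum>l\<le>d. g k c * g l c * ?W k l c))"
      by (intro polyfun_mult polyfun_sum polyfun_power w assms polyfun.const)
    fix c a b assume ab: "a + b = s c" "a * b = p c"
    have "(\<Sum>k\<le>d. \<Sum>l\<le>d. g k c * g l c * ?W k l c) =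
        (\<Sum>k\<le>d. \<Sum>l\<le>d. (g k c * a ^ k) * (g l c * b ^ l)) +
        (\<Sum>k\<le>d. \<Sum>l\<le>d. (g l c * a ^ l) * (g k c * b ^ k))"
      unfolding W[OF ab] by (simp add: algebra_simps sum.distrib)
    also have "(\<Sum>k\<le>d. \<Sum>l\<le>d. (g l c * a ^ l) * (g k c * b ^ k)) =
        (\<Sum>k\<le>d. \<Sum>l\<le>d. (g k c * a ^ k) * (g l c * b ^ l))"
      by (rule sum.swap)
    finally show "(1 / 2) * (\<Sum>k\<le>d. \<Sum>l\<le>d. g k c * g l c * ?W k l c) =
        (\<Sum>k\<le>d. g k c * a ^ k) * (\<Sum>k\<le>d. g k c * b ^ k)"
      by (simp add: sum_product)
  qed
qed

subsection \<open>The cycle polynomial as a product over signs\<close>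

text \<open>\<open>A\<close> collects the indices with a minus sign. It will range over the subsets
  of \<open>{1..m}\<close>, which leaves \<open>x 0\<close> positive and gives \<open>2 ^ m\<close>
  sign patterns. The type is general because real angles are needed as well as complex ones.\<close>

definition signed_sum :: "nat \<Rightarrow> nat set \<Rightarrow> (nat \<Rightarrow> 'a) \<Rightarrow> 'a::ab_group_add" where
  "signed_sum m A x = (\<Sum>i\<le>m. if i \<in> A then - x i else x i)"

lemma signed_sum_Suc:
  assumes "A \<in> Pow {1..m}"
  shows "signed_sum (Suc m) A x = signed_sum m A x + x (Suc m)"
    "signed_sum (Suc m) (insert (Suc m) A) x = signed_sum m A x - x (Suc m)"
proof -
  have "Suc m \<notin> A" using assms by auto
  moreover have "(\<Sum>i\<le>m. if i \<in> insert (Suc m) A then - x i else x i) = signed_sum m A x"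
    unfolding signed_sum_def by (rule sum.cong) auto
  ultimately show "signed_sum (Suc m) A x = signed_sum m A x + x (Suc m)"
    "signed_sum (Suc m) (insert (Suc m) A) x = signed_sum m A x - x (Suc m)"
    by (simp_all add: signed_sum_def)
qed

lemma Pow_atLeastAtMost_Suc:
  "Pow {1..Suc m} = Pow {1..m} \<union> insert (Suc m) ` Pow {1..m}"
  by (simp add: atLeastAtMostSuc_conv Pow_insert)

lemma prod_signed_sum_Suc:
  "(\<Prod>A \<in> Pow {1..Suc m}. h (signed_sum (Suc m) A x)) =
    (\<Prod>A \<in> Pow {1..m}. h (signed_sum m A x + x (Suc m)) * h (signed_sum m A x - x (Suc m)))"
proof -
  have "inj_on (insert (Suc m)) (Pow {1..m})"
  proof (rule inj_onI)
    fix A B assume "A \<in> Pow {1..m}" "B \<in> Pow {1..m}" "insert (Suc m) A = insert (Suc m) B"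
    moreover from calculation have "Suc m \<notin> A" "Suc m \<notin> B" by auto
    ultimately show "A = B" by (simp add: insert_ident)
  qed
  moreover have "Pow {1..m} \<inter> insert (Suc m) ` Pow {1..m} = {}" by auto
  ultimately show ?thesis
    unfolding Pow_atLeastAtMost_Suc
    by (simp add: prod.union_disjoint prod.reindex signed_sum_Suc prod.distrib)
qed

text \<open>With the next lemma: \<open>cos (a + b)\<close> and \<open>cos (a - b)\<close> are the
  roots of a quadratic polynomial whose coefficients are polynomials in \<open>cos a\<close> and
  \<open>cos b\<close>.\<close>

lemma cos_add_plus_cos_diff: "cos (a + b) + cos (a - b) = 2 * cos a * cos (b :: complex)"
  by (simp add: cos_add cos_diff)

lemma cos_add_times_cos_diff: "cos (a + b) * cos (a - b) = (cos a)\<^sup>2 + (cos (b :: complex))\<^sup>2 - 1"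
proof -
  have "cos (a + b) * cos (a - b) = (cos a)\<^sup>2 * (cos b)\<^sup>2 - (sin a)\<^sup>2 * (sin b)\<^sup>2"
    by (simp add: cos_add cos_diff power2_eq_square algebra_simps)
  then show ?thesis by (simp add: sin_squared_eq algebra_simps)
qed

text \<open>Since the complex cosine is surjective, this determines \<open>F\<close>. Fixing the sign of the angle
  with index \<open>0\<close> accounts for the evenness of the cosine.\<close>

definition cyclefun :: "nat \<Rightarrow> ((nat \<Rightarrow> complex) \<Rightarrow> complex) \<Rightarrow> bool" where
  "cyclefun m F \<longleftrightarrow> polyfun (Suc (Suc m)) F \<and>
    (\<forall>c x. (\<forall>i\<le>m. c i = cos (x i)) \<longrightarrow>
      F c = (\<Prod>A \<in> Pow {1..m}. c (Suc m) - cos (signed_sum m A x)))"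

lemma cyclefun_eq:
  assumes "cyclefun m F" "\<And>i. i \<le> m \<Longrightarrow> c i = cos (x i)"
  shows "F c = (\<Prod>A \<in> Pow {1..m}. c (Suc m) - cos (signed_sum m A x))"
  using assms unfolding cyclefun_def by blast

text \<open>Let \<open>u\<close> be an angle of the new last coordinate and \<open>y\<close> the
  additional angle. The function for \<open>m\<close>, evaluated with last coordinate
  \<open>cos (u + y)\<close> and \<open>cos (u - y)\<close>, gives two values whose product is the
  function for \<open>Suc m\<close>; as a norm it is polynomial in \<open>cos u\<close> and
  \<open>cos y\<close>.\<close>

lemma cyclefun_exists: "\<exists>F. cyclefun m F"
proof (induction m)
  case 0
  show ?case
    by (intro exI[of _ "\<lambda>c. c 1 - c 0"])
      (auto simp: cyclefun_def signed_sum_def intro: polyfun_diff polyfun_coord)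
next
  case (Suc m)
  then obtain F where F: "polyfun (Suc (Suc m)) F"
    "\<And>c x. (\<forall>i\<le>m. c i = cos (x i)) \<Longrightarrow>
      F c = (\<Prod>A \<in> Pow {1..m}. c (Suc m) - cos (signed_sum m A x))"
    by (auto simp: cyclefun_def)
  obtain d g where g: "\<And>k. polyfun (Suc m) (g k)"
    "\<And>c. F c = (\<Sum>k\<le>d. g k c * c (Suc m) ^ k)"
    using polyfun_expand[OF F(1)] by (metis order_refl)
  let ?n = "Suc (Suc (Suc m))"
  have g': "polyfun ?n (g k)" for k
    by (rule polyfun_mono[OF g(1)]) simp
  have s: "polyfun ?n (\<lambda>c. 2 * c (Suc m) * c (Suc (Suc m)))"
    by (intro polyfun_mult polyfun_coord polyfun.const) auto
  have p: "polyfun ?n (\<lambda>c. (c (Suc m))\<^sup>2 + (c (Suc (Suc m)))\<^sup>2 - 1)"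
    by (intro polyfun_diff polyfun_power polyfun_coord polyfun.const polyfun.add) auto
  obtain G where G: "polyfun ?n G"
    "\<And>c a b. a + b = 2 * c (Suc m) * c (Suc (Suc m)) \<Longrightarrow>
      a * b = (c (Suc m))\<^sup>2 + (c (Suc (Suc m)))\<^sup>2 - 1 \<Longrightarrow>
      G c = (\<Sum>k\<le>d. g k c * a ^ k) * (\<Sum>k\<le>d. g k c * b ^ k)"
    by (rule polyfun_norm[OF g' s p, where d = d]) (rule that)
  have "G c = (\<Prod>A \<in> Pow {1..Suc m}. c (Suc (Suc m)) - cos (signed_sum (Suc m) A x))"
    if c: "\<forall>i\<le>Suc m. c i = cos (x i)" for c x
  proof -
    define u where "u = Arccos (c (Suc (Suc m)))"
    have u: "c (Suc (Suc m)) = cos u" by (simp add: u_def)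
    let ?y = "x (Suc m)"
    define a b where "a = cos (u + ?y)" and "b = cos (u - ?y)"
    have ab: "a + b = 2 * c (Suc m) * c (Suc (Suc m))"
      "a * b = (c (Suc m))\<^sup>2 + (c (Suc (Suc m)))\<^sup>2 - 1"
      using c by (simp_all add: a_def b_def u cos_add_plus_cos_diff cos_add_times_cos_diff)
    \<comment> \<open>The coefficients do not involve the coordinate \<open>Suc m\<close>, so it may
      be replaced by an arbitrary \<open>z\<close> in the product formula for
      \<open>F\<close>.\<close>
    have val: "(\<Sum>k\<le>d. g k c * z ^ k) = (\<Prod>A \<in> Pow {1..m}. z - cos (signed_sum m A x))" for z
    proof -
      have "g k (c(Suc m := z)) = g k c" for k
        by (rule polyfun_cong[OF g(1)]) simp
      then show ?thesis
        using g(2)[of "c(Suc m := z)"] F(2)[of "c(Suc m := z)" x] c by simp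
    qed
    \<comment> \<open>Both sides expand to an expression symmetric in \<open>u\<close> and
      \<open>w\<close>, so the shift by \<open>y\<close> can be moved from \<open>u\<close> to
      \<open>w\<close>.\<close>
    have "(a - cos w) * (b - cos w) =
        (c (Suc (Suc m)) - cos (w + ?y)) * (c (Suc (Suc m)) - cos (w - ?y))" for w
    proof -
      have "(a - cos w) * (b - cos w) = a * b - (a + b) * cos w + (cos w)\<^sup>2"
        by (simp add: algebra_simps power2_eq_square)
      also have "\<dots> = (cos u)\<^sup>2 - cos u * (2 * cos w * cos ?y) + ((cos w)\<^sup>2 + (cos ?y)\<^sup>2 - 1)"
        using c by (simp add: ab u algebra_simps)
      also have "\<dots> = (cos u - cos (w + ?y)) * (cos u - cos (w - ?y))"
        unfolding cos_add_plus_cos_diff[symmetric] cos_add_times_cos_diff[symmetric]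
        by (simp add: algebra_simps power2_eq_square)
      finally show ?thesis by (simp add: u)
    qed
    then have "(\<Prod>A \<in> Pow {1..m}. (a - cos (signed_sum m A x)) * (b - cos (signed_sum m A x))) =
        (\<Prod>A \<in> Pow {1..Suc m}. c (Suc (Suc m)) - cos (signed_sum (Suc m) A x))"
      unfolding prod_signed_sum_Suc[where h = "\<lambda>w. c (Suc (Suc m)) - cos w"] by simp
    then show ?thesis
      unfolding G(2)[OF ab] val prod.distrib .
  qed
  then show ?case using G(1) by (auto simp: cyclefun_def)
qed

text \<open>For fixed \<open>c 0, ..., c m\<close> the expansion in the last coordinate agrees
  everywhere with a product of \<open>2 ^ m\<close> monic linear factors, so the coefficients can be
  compared.\<close>

lemma cyclefun_monic:
  assumes "cyclefun m F"
  obtains p where "\<And>k. polyfun (Suc m) (p k)"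
    "\<And>c. F c = c (Suc m) ^ (2 ^ m) + (\<Sum>k<2 ^ m. p k c * c (Suc m) ^ k)"
proof -
  obtain d g where g: "\<And>k. polyfun (Suc m) (g k)"
    "\<And>c. F c = (\<Sum>k\<le>d. g k c * c (Suc m) ^ k)"
    using polyfun_expand[of "Suc m" F] assms unfolding cyclefun_def by (metis order_refl)
  \<comment> \<open>The expansion says nothing about \<open>g k\<close> beyond \<open>d\<close>;
    cutting off there makes \<open>h k c\<close> the true coefficient for every
    \<open>k\<close>.\<close>
  define h where "h k c = (if k \<le> d then g k c else 0)" for k c
  have h: "polyfun (Suc m) (h k)" for k
    unfolding h_def using g(1) by (cases "k \<le> d") (auto intro: polyfun.const)
  have "F c = c (Suc m) ^ (2 ^ m) + (\<Sum>k<2 ^ m. h k c * c (Suc m) ^ k)" for c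
  proof -
    define r where "r A = cos (signed_sum m A (\<lambda>i. Arccos (c i)))" for A
    let ?Q = "\<Prod>A \<in> Pow {1..m}. [:- r A, 1:]"
    have eq: "poly (\<Sum>k\<le>d. monom (g k c) k) z = poly ?Q z" for z
    proof -
      have "g k (c(Suc m := z)) = g k c" for k
        by (rule polyfun_cong[OF g(1)]) simp
      then have "poly (\<Sum>k\<le>d. monom (g k c) k) z = F (c(Suc m := z))"
        by (simp add: g(2) poly_sum poly_monom)
      also have "\<dots> = (\<Prod>A \<in> Pow {1..m}. (c(Suc m := z)) (Suc m) - r A)"
        unfolding r_def by (rule cyclefun_eq[OF assms]) simp
      finally show ?thesis by (simp add: poly_prod)
    qed
    have "poly ?Q = poly (\<Sum>k\<le>d. monom (g k c) k)"
      by (rule ext) (rule eq[symmetric])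
    then have Q: "?Q = (\<Sum>k\<le>d. monom (g k c) k)"
      by (rule poly_eq_poly_eq_iff[THEN iffD1])
    have coeff: "coeff ?Q k = h k c" for k
      unfolding Q h_def by (simp add: coeff_sum)
    have deg: "degree ?Q = 2 ^ m"
      by (subst degree_prod_eq_sum_degree) (auto simp: card_Pow)
    have "coeff ?Q (degree ?Q) = 1" by (subst lead_coeff_prod) simp
    then have "h (2 ^ m) c = 1" unfolding deg coeff .
    moreover have "F c = poly ?Q (c (Suc m))"
      unfolding Q by (simp add: g(2) poly_sum poly_monom)
    then have "F c = (\<Sum>k\<le>2 ^ m. h k c * c (Suc m) ^ k)"
      unfolding poly_altdef deg coeff .
    ultimately show ?thesis by (simp flip: lessThan_Suc_atMost)
  qed
  then show thesis using that h by blast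
qed

section \<open>Distinct roots over a box of real angles\<close>

text \<open>On this box the first angle dominates all signed sums, and they stay inside \<open>(0, \<pi>)\<close>.\<close>

lemma signed_sum_bounds:
  fixes x :: "nat \<Rightarrow> real"
  assumes "\<And>i. i \<le> m \<Longrightarrow> x i \<in> {1 / 4 ^ i..2 / 4 ^ i}" "A \<in> Pow {1..m}"
  shows "signed_sum m A x \<in> {1 / 3 + 2 / 3 / 4 ^ m..8 / 3 - 2 / 3 / 4 ^ m}"
  using assms
proof (induction m arbitrary: A)
  case 0
  then show ?case using "0.prems"(1)[of 0] by (auto simp: signed_sum_def)
next
  case (Suc m)
  have x: "x (Suc m) \<in> {1 / 4 ^ Suc m..2 / 4 ^ Suc m}" using Suc.prems by blast
  have IH: "signed_sum m B x \<in> {1 / 3 + 2 / 3 / 4 ^ m..8 / 3 - 2 / 3 / 4 ^ m}"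
    if "B \<in> Pow {1..m}" for B
    using Suc.IH Suc.prems(1) that by simp
  from Suc.prems(2) consider "A \<in> Pow {1..m}"
    | B where "B \<in> Pow {1..m}" "A = insert (Suc m) B"
    unfolding Pow_atLeastAtMost_Suc by blast
  then show ?case
  proof cases
    case 1
    with IH[OF 1] x show ?thesis by (simp add: signed_sum_Suc field_simps)
  next
    case 2
    with IH[OF 2(1)] x show ?thesis by (simp add: signed_sum_Suc field_simps)
  qed
qed

text \<open>Put \<open>e = 1 / 4 ^ Suc m\<close> in the induction step. Different prefixes are at
  least \<open>6 * e\<close> apart, and the two last terms change this by at most
  \<open>4 * e\<close>. Equal prefixes give a gap of twice the last angle, at least
  \<open>2 * e\<close>. Both exceed the required \<open>3 / 2 * e\<close>.\<close>

lemma signed_sum_separated: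
  fixes x :: "nat \<Rightarrow> real"
  assumes "\<And>i. i \<le> m \<Longrightarrow> x i \<in> {1 / 4 ^ i..2 / 4 ^ i}" "A \<in> Pow {1..m}" "B \<in> Pow {1..m}" "A \<noteq> B"
  shows "\<bar>signed_sum m A x - signed_sum m B x\<bar> \<ge> 6 / 4 ^ Suc m"
  using assms
proof (induction m arbitrary: A B)
  case 0
  then show ?case by auto
next
  case (Suc m)
  define s where "s C = signed_sum m C x" for C
  have x: "x (Suc m) \<in> {1 / 4 ^ Suc m..2 / 4 ^ Suc m}" using Suc.prems by blast
  have IH: "\<bar>s C - s D\<bar> \<ge> 6 / 4 ^ Suc m"
    if "C \<in> Pow {1..m}" "D \<in> Pow {1..m}" "C \<noteq> D" for C D
    unfolding s_def using Suc.IH Suc.prems(1) that by simp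
  define e :: real where "e = 1 / 4 ^ Suc m"
  have e: "6 / 4 ^ Suc m = 6 * e" "6 / 4 ^ Suc (Suc m) = 3 / 2 * e" "x (Suc m) \<in> {e..2 * e}" "e > 0"
    using x by (simp_all add: e_def)
  have rep: "\<exists>D \<in> Pow {1..m}. \<exists>b. C = (if b then insert (Suc m) D else D) \<and>
      signed_sum (Suc m) C x = (if b then s D - x (Suc m) else s D + x (Suc m))"
    if "C \<in> Pow {1..Suc m}" for C
  proof -
    from that consider "C \<in> Pow {1..m}"
      | D where "D \<in> Pow {1..m}" "C = insert (Suc m) D"
      unfolding Pow_atLeastAtMost_Suc by blast
    then show ?thesis
    proof cases
      case 1
      then show ?thesis by (intro bexI[of _ C] exI[of _ False]) (auto simp: signed_sum_Suc s_def)
    next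
      case 2
      then show ?thesis by (intro bexI[of _ D] exI[of _ True]) (auto simp: signed_sum_Suc s_def)
    qed
  qed
  obtain D b where D: "D \<in> Pow {1..m}" "A = (if b then insert (Suc m) D else D)"
      "signed_sum (Suc m) A x = (if b then s D - x (Suc m) else s D + x (Suc m))"
    using rep[OF Suc.prems(2)] by blast
  obtain D' b' where D': "D' \<in> Pow {1..m}" "B = (if b' then insert (Suc m) D' else D')"
      "signed_sum (Suc m) B x = (if b' then s D' - x (Suc m) else s D' + x (Suc m))"
    using rep[OF Suc.prems(3)] by blast
  show ?case
  proof (cases "D = D'")
    case True
    then have "b \<noteq> b'" using D(2) D'(2) Suc.prems(4) by blast
    then show ?thesis unfolding D(3) D'(3) using True e by auto
  next
    case False
    then show ?thesis unfolding D(3) D'(3) using IH[OF D(1) D'(1)] e by auto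
  qed
qed

text \<open>On the box all signed sums are distinct reals in \<open>{0..pi}\<close>, where the
  cosine is injective.\<close>

lemma cos_signed_sum_inj:
  fixes x :: "nat \<Rightarrow> real"
  assumes "\<And>i. i \<le> m \<Longrightarrow> x i \<in> {1 / 4 ^ i..2 / 4 ^ i}"
  shows "inj_on (\<lambda>A. cos (signed_sum m A (\<lambda>i. complex_of_real (x i)))) (Pow {1..m})"
proof (rule inj_onI)
  fix A B assume AB: "A \<in> Pow {1..m}" "B \<in> Pow {1..m}"
    and eq: "cos (signed_sum m A (\<lambda>i. complex_of_real (x i))) =
      cos (signed_sum m B (\<lambda>i. complex_of_real (x i)))"
  have of_real: "signed_sum m C (\<lambda>i. complex_of_real (x i)) = of_real (signed_sum m C x)" for C
    by (simp add: signed_sum_def if_distrib cong: if_cong)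
  have "signed_sum m C x \<in> {0..pi}" if "C \<in> Pow {1..m}" for C
  proof -
    define e :: real where "e = 2 / 3 / 4 ^ m"
    have "e > 0" by (simp add: e_def)
    moreover have "signed_sum m C x \<in> {1 / 3 + e..8 / 3 - e}"
      unfolding e_def by (rule signed_sum_bounds[OF assms that])
    ultimately show ?thesis using pi_gt3 by auto
  qed
  then have "signed_sum m A x = signed_sum m B x"
    using eq AB unfolding of_real cos_of_real of_real_eq_iff
    by (metis atLeastAtMost_iff cos_inj_pi)
  moreover have "6 / 4 ^ Suc m \<le> \<bar>signed_sum m A x - signed_sum m B x\<bar>" if "A \<noteq> B"
    using assms AB that by (rule signed_sum_separated)
  moreover have "(0 :: real) < 6 / 4 ^ Suc m" by simp
  ultimately show "A = B" by (metis abs_zero cancel_comm_monoid_add_class.diff_cancel not_le)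
qed

text \<open>The remainder modulo \<open>F\<close> has degree below \<open>2 ^ m\<close> in the last
  coordinate, yet over the box it has \<open>2 ^ m\<close> distinct roots. Its coefficients thus
  vanish on a product of infinite sets, hence everywhere.\<close>

lemma cyclefun_dvd:
  assumes F: "cyclefun m F" and f: "polyfun (Suc (Suc m)) f"
    and vanish: "\<And>x. (\<Sum>i\<le>Suc m. x i) = 0 \<Longrightarrow> f (\<lambda>i. cos (x i)) = 0"
  obtains q where "polyfun (Suc (Suc m)) q" "\<And>c. f c = q c * F c"
proof -
  obtain p where p: "\<And>k. polyfun (Suc m) (p k)"
    "\<And>c. F c = c (Suc m) ^ (2 ^ m) + (\<Sum>k<2 ^ m. p k c * c (Suc m) ^ k)"
    using cyclefun_monic[OF F] by blast
  obtain q r where q: "polyfun (Suc (Suc m)) q" and r: "\<And>k. polyfun (Suc m) (r k)"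
    and fqr: "\<And>c. f c = q c * F c + (\<Sum>k<2 ^ m. r k c * c (Suc m) ^ k)"
    using polyfun_division[OF f p(1) _ p(2)] by auto
  have root: "(\<Sum>k<2 ^ m. r k c * cos (signed_sum m A x) ^ k) = 0"
    if c: "\<And>i. i \<le> m \<Longrightarrow> c i = cos (x i)" and A: "A \<in> Pow {1..m}" for c x A
  proof -
    let ?z = "signed_sum m A x"
    \<comment> \<open>The angles with their signs applied, completed to total sum 0. The cosine is
      even, so only the last coordinate of \<open>c\<close> changes.\<close>
    let ?x = "\<lambda>i. if i \<le> m then if i \<in> A then - x i else x i else - ?z"
    let ?c = "c(Suc m := cos ?z)"
    have "f (\<lambda>i. cos (?x i)) = 0"
      by (rule vanish) (simp add: signed_sum_def)
    moreover have "f (\<lambda>i. cos (?x i)) = f ?c"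
      by (rule polyfun_cong[OF f]) (auto simp: c)
    moreover have "F ?c = (\<Prod>A \<in> Pow {1..m}. ?c (Suc m) - cos (signed_sum m A x))"
      by (rule cyclefun_eq[OF F]) (simp add: c)
    then have "F ?c = 0" using A by (auto intro!: prod_zero)
    moreover have "r k ?c = r k c" for k
      by (rule polyfun_cong[OF r]) simp
    ultimately show ?thesis using fqr[of ?c] by simp
  qed
  have "r k c = 0" if "k < 2 ^ m" for k c
  proof (rule ccontr)
    assume "r k c \<noteq> 0"
    let ?S = "\<lambda>i. (\<lambda>x :: real. cos (complex_of_real x)) ` {1 / 4 ^ i..2 / 4 ^ i}"
    have "infinite (?S i)" for i
    proof -
      have "2 / 4 ^ i \<le> (2 :: real)" by (simp add: field_simps)
      then have hi: "2 / 4 ^ i \<le> pi" using pi_gt3 by linarith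
      have lo: "0 \<le> 1 / (4 :: real) ^ i" by simp
      have "inj_on (\<lambda>x :: real. cos (complex_of_real x)) {1 / 4 ^ i..2 / 4 ^ i}"
        unfolding inj_on_def cos_of_real of_real_eq_iff
      proof (intro ballI impI)
        fix x y :: real
        assume xy: "x \<in> {1 / 4 ^ i..2 / 4 ^ i}" "y \<in> {1 / 4 ^ i..2 / 4 ^ i}" "cos x = cos y"
        have bounds: "0 \<le> w \<and> w \<le> pi" if "w \<in> {1 / 4 ^ i..2 / 4 ^ i}" for w
          using that lo hi unfolding atLeastAtMost_iff by linarith
        show "x = y"
          using bounds[OF xy(1)] bounds[OF xy(2)] xy(3) cos_inj_pi by blast
      qed
      then show ?thesis by (simp add: finite_image_iff field_simps)
    qed
    then obtain v where v: "\<And>i. i < Suc m \<Longrightarrow> v i \<in> ?S i" "r k v \<noteq> 0"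
      using polyfun_nonzero_on_product[OF r \<open>r k c \<noteq> 0\<close>, of ?S] by blast
    have "\<forall>i. \<exists>x. i \<le> m \<longrightarrow> x \<in> {1 / 4 ^ i..2 / 4 ^ i} \<and> v i = cos (complex_of_real x)"
      using v(1) unfolding less_Suc_eq_le image_iff Bex_def by blast
    then obtain x where x: "\<And>i. i \<le> m \<Longrightarrow> x i \<in> {1 / 4 ^ i..2 / 4 ^ i}"
      "\<And>i. i \<le> m \<Longrightarrow> v i = cos (complex_of_real (x i))" by metis
    define R where "R = (\<Sum>k<2 ^ m. monom (r k v) k)"
    let ?roots = "(\<lambda>A. cos (signed_sum m A (\<lambda>i. complex_of_real (x i)))) ` Pow {1..m}"
    have "coeff R k = r k v" using that by (simp add: R_def coeff_sum)
    then have "R \<noteq> 0" using v(2) by auto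
    have "?roots \<subseteq> {z. poly R z = 0}"
      using root[of v, OF x(2)] by (auto simp: R_def poly_sum poly_monom)
    moreover have "card ?roots = 2 ^ m"
      by (subst card_image[OF cos_signed_sum_inj[OF x(1)]]) (simp_all add: card_Pow)
    ultimately have "2 ^ m \<le> degree R"
      using card_mono[OF poly_roots_finite[OF \<open>R \<noteq> 0\<close>]] card_poly_roots_bound[OF \<open>R \<noteq> 0\<close>]
      by (metis order_trans)
    moreover have "degree R \<le> 2 ^ m - 1"
      unfolding R_def by (intro degree_sum_le) (auto intro: order_trans[OF degree_monom_le])
    moreover have "(0 :: nat) < 2 ^ m" by simp
    ultimately show False by linarith
  qed
  then have "f c = q c * F c" for c using fqr[of c] by simp
  then show thesis using that q by blast
qed

subsection \<open>The vanishing ideal\<close>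

text \<open>Each row has a 1 in its own column and -1 in the last, so a combination with
  coefficients \<open>y\<close> consists of \<open>y\<close> followed by minus the sum of its
  entries.\<close>

lemma Row_cycle_matrix:
  "Row (cycle_matrix (Suc M)) = {x \<in> carrier_vec (Suc M). (\<Sum>i\<le>M. vec_index x i) = 0}"
proof -
  let ?A = "map_mat of_int (cycle_matrix (Suc M)) :: complex mat"
  have A: "?A \<in> carrier_mat M (Suc M)"
    by (simp add: cycle_matrix_def)
  have dim: "dim_col (cycle_matrix (Suc M)) = Suc M"
    by (simp add: cycle_matrix_def)
  have mult: "vec_index (transpose_mat ?A *\<^sub>v y) j =
      (if j = M then - (\<Sum>i<M. vec_index y i) else vec_index y j)"
    if "y \<in> carrier_vec M" "j \<le> M" for y j
  proof -
    have "vec_index (transpose_mat ?A *\<^sub>v y) j = (\<Sum>i<M. (if j = M then - 1 else if i = j then 1 else 0) * vec_index y i)"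
      using that by (auto simp: cycle_matrix_def scalar_prod_def atLeast0LessThan intro!: sum.cong)
    then show ?thesis
      using that by (auto simp: sum_negf if_distrib[of "\<lambda>x. x * _"] cong: if_cong)
  qed
  have "(\<exists>y \<in> carrier_vec M. transpose_mat ?A *\<^sub>v y = x) \<longleftrightarrow> (\<Sum>i\<le>M. vec_index x i) = 0"
    if x: "x \<in> carrier_vec (Suc M)" for x
  proof
    assume "\<exists>y \<in> carrier_vec M. transpose_mat ?A *\<^sub>v y = x"
    then obtain y where y: "y \<in> carrier_vec M" "transpose_mat ?A *\<^sub>v y = x" by blast
    have "(\<Sum>i\<le>M. vec_index x i) = (\<Sum>i\<le>M. if i = M then - (\<Sum>i<M. vec_index y i) else vec_index y i)"
      unfolding y(2)[symmetric] by (rule sum.cong) (auto simp: mult[OF y(1)])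
    then show "(\<Sum>i\<le>M. vec_index x i) = 0"
      by (simp flip: lessThan_Suc_atMost)
  next
    assume sum: "(\<Sum>i\<le>M. vec_index x i) = 0"
    let ?y = "Matrix.vec M (vec_index x)"
    have "transpose_mat ?A *\<^sub>v ?y = x"
    proof (rule eq_vecI)
      show "dim_vec (transpose_mat ?A *\<^sub>v ?y) = dim_vec x" using x A by simp
      fix j assume "j < dim_vec x"
      then have "j \<le> M" using x by simp
      then show "vec_index (transpose_mat ?A *\<^sub>v ?y) j = vec_index x j"
        using sum by (subst mult) (auto simp: add_eq_0_iff2 simp flip: lessThan_Suc_atMost)
    qed
    then show "\<exists>y \<in> carrier_vec M. transpose_mat ?A *\<^sub>v y = x" by auto
  qed
  then show ?thesis
    using A unfolding Row_def dim vec_space.row_space_eq[OF A] by auto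
qed

lemma polyfun_of_peval:
  assumes "p \<in> polys_in n"
  shows "polyfun n (peval p)"
proof -
  have "i < n" if "m \<in> Poly_Mapping.keys p" "i \<in> Poly_Mapping.keys m" for m i
    using assms that unfolding polys_in_def by blast
  then show ?thesis
    unfolding peval_def meval_def
    by (intro polyfun_sum polyfun_mult polyfun_prod polyfun_power polyfun_coord polyfun.const)
qed

lemma mem_vanishing_ideal:
  assumes "p \<in> polys_in (Suc M)"
  shows "p \<in> vanishing_ideal (Suc M) (cosine_variety (cycle_matrix (Suc M))) \<longleftrightarrow>
    (\<forall>x. (\<Sum>i\<le>M. x i) = 0 \<longrightarrow> peval p (\<lambda>i. cos (x i)) = 0)"
proof -
  have eval: "poly_eval p (map_vec cos v) = peval p (\<lambda>i. cos (vec_index v i))"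
    if "v \<in> carrier_vec (Suc M)" for v
    unfolding poly_eval_eq_peval by (rule peval_cong[OF assms]) (use that in auto)
  have vec: "peval p (\<lambda>i. cos (vec_index (Matrix.vec (Suc M) x) i)) = peval p (\<lambda>i. cos (x i))" for x
    by (rule peval_cong[OF assms]) auto
  have sum: "(\<Sum>i\<le>M. vec_index (Matrix.vec (Suc M) x) i) = (\<Sum>i\<le>M. x i)" for x :: "nat \<Rightarrow> complex"
    by (rule sum.cong) auto
  have "p \<in> vanishing_ideal (Suc M) (cosine_variety (cycle_matrix (Suc M))) \<longleftrightarrow>
      (\<forall>v \<in> carrier_vec (Suc M). (\<Sum>i\<le>M. vec_index v i) = 0 \<longrightarrow> peval p (\<lambda>i. cos (vec_index v i)) = 0)"
    using assms unfolding vanishing_ideal_def cosine_variety_def Row_cycle_matrix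
    by (auto simp: eval)
  also have "\<dots> \<longleftrightarrow> (\<forall>x. (\<Sum>i\<le>M. x i) = 0 \<longrightarrow> peval p (\<lambda>i. cos (x i)) = 0)"
  proof (intro iffI allI impI ballI)
    fix x :: "nat \<Rightarrow> complex"
    assume *: "\<forall>v \<in> carrier_vec (Suc M). (\<Sum>i\<le>M. vec_index v i) = 0 \<longrightarrow> peval p (\<lambda>i. cos (vec_index v i)) = 0"
      and x: "(\<Sum>i\<le>M. x i) = 0"
    from *[rule_format, of "Matrix.vec (Suc M) x"] show "peval p (\<lambda>i. cos (x i)) = 0"
      unfolding vec sum using x by simp
  qed simp
  finally show ?thesis .
qed

subsection \<open>Orders of growth\<close>

text \<open>\<open>h\<close> is the homogeneous part of \<open>p\<close> of top degree. Multiplied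
  by \<open>t ^ total_degree p\<close>, a monomial of lower degree keeps a positive power of
  \<open>t\<close> and disappears in the limit.\<close>

lemma peval_leading_form:
  assumes p: "p \<in> polys_in n" "p \<noteq> 0"
  obtains h u where "polyfun n h" "h u \<noteq> 0"
    "\<And>y a. (\<And>i. i < n \<Longrightarrow> ((\<lambda>t. t * y t i) \<longlongrightarrow> a i) (at 0)) \<Longrightarrow>
      ((\<lambda>t. t ^ total_degree p * peval p (y t)) \<longlongrightarrow> h a) (at 0)"
proof -
  let ?K = "Poly_Mapping.keys p"
  define w where "w m = (\<Sum>i \<in> Poly_Mapping.keys m. Poly_Mapping.lookup m i)" for m :: "nat \<Rightarrow>\<^sub>0 nat"
  define D where "D = total_degree p"
  have D: "D = Max (insert 0 (w ` ?K))" by (simp add: D_def total_degree_def w_def)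
  have le: "w m \<le> D" if "m \<in> ?K" for m unfolding D using that by (intro Max_ge) auto
  obtain l where l: "l \<in> ?K" using p(2) by (meson ex_in_conv keys_eq_empty)
  have "D \<in> insert 0 (w ` ?K)" unfolding D by (rule Max_in) auto
  then obtain m where m: "m \<in> ?K" "w m = D" using l le[OF l] by auto
  define q where "q = (\<Sum>m \<in> {m \<in> ?K. w m = D}. Poly_Mapping.single m (Poly_Mapping.lookup p m))"
  have lookup_q: "Poly_Mapping.lookup q m = (if m \<in> ?K \<and> w m = D then Poly_Mapping.lookup p m else 0)" for m
    by (auto simp: q_def lookup_sum lookup_single when_def)
  have "Poly_Mapping.keys q \<subseteq> ?K" by (auto simp: in_keys_iff lookup_q)
  then have q: "q \<in> polys_in n" using p(1) by (auto simp: polys_in_def)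
  have "Poly_Mapping.lookup q m \<noteq> 0" using m by (simp add: lookup_q in_keys_iff)
  then have "q \<noteq> 0" by auto
  then obtain u where u: "peval q u \<noteq> 0" using peval_nonzero[OF q] by blast
  show thesis
  proof (rule that[of "peval q" u])
    show "polyfun n (peval q)" by (rule polyfun_of_peval[OF q])
    show "peval q u \<noteq> 0" by (rule u)
    fix y :: "complex \<Rightarrow> nat \<Rightarrow> complex" and a
    assume lim: "\<And>i. i < n \<Longrightarrow> ((\<lambda>t. t * y t i) \<longlongrightarrow> a i) (at 0)"
    have lt: "i < n" if "m \<in> ?K" "i \<in> Poly_Mapping.keys m" for m i
      using p(1) that unfolding polys_in_def by blast
    have "t ^ D * meval m (y t) = t ^ (D - w m) * meval m (\<lambda>i. t * y t i)" if "m \<in> ?K" for m t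
    proof -
      have "t ^ D = t ^ (D - w m) * t ^ w m" using le[OF that] by (simp flip: power_add)
      then show ?thesis
        by (simp add: meval_def w_def power_mult_distrib prod.distrib power_sum)
    qed
    then have "t ^ D * peval p (y t) =
        (\<Sum>m \<in> ?K. Poly_Mapping.lookup p m * (t ^ (D - w m) * meval m (\<lambda>i. t * y t i)))" for t
      unfolding peval_def sum_distrib_left
      by (intro sum.cong refl) (simp add: mult.left_commute)
    moreover have "((\<lambda>t. \<Sum>m \<in> ?K. Poly_Mapping.lookup p m * (t ^ (D - w m) * meval m (\<lambda>i. t * y t i))) \<longlongrightarrow>
        (\<Sum>m \<in> ?K. Poly_Mapping.lookup p m * (0 ^ (D - w m) * meval m a))) (at 0)"
      unfolding meval_def by (intro tendsto_intros lim lt)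
    \<comment> \<open>Since \<open>0 ^ 0 = 1\<close>, exactly the terms of top degree
      survive.\<close>
    moreover have "(\<Sum>m \<in> ?K. Poly_Mapping.lookup p m * (0 ^ (D - w m) * meval m a)) = peval q a"
    proof -
      have "Poly_Mapping.lookup p m * (0 ^ (D - w m) * meval m a) = Poly_Mapping.lookup q m * meval m a"
        if "m \<in> ?K" for m
        using le[OF that] that by (auto simp: lookup_q power_0_left)
      then show ?thesis
        unfolding peval_superset[OF finite_keys \<open>Poly_Mapping.keys q \<subseteq> ?K\<close>]
        by (intro sum.cong refl)
    qed
    ultimately show "((\<lambda>t. t ^ total_degree p * peval p (y t)) \<longlongrightarrow> peval q a) (at 0)"
      by (simp add: D_def)
  qed
qed

text \<open>If \<open>i < j\<close>, then \<open>t ^ j * f t\<close> is \<open>t ^ (j - i)\<close>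
  times a convergent function and tends to 0.\<close>

lemma growth_exponent_unique:
  fixes f :: "complex \<Rightarrow> complex"
  assumes "((\<lambda>t. t ^ i * f t) \<longlongrightarrow> a) (at 0)" "a \<noteq> 0"
    and "((\<lambda>t. t ^ j * f t) \<longlongrightarrow> b) (at 0)" "b \<noteq> 0"
  shows "i = j"
proof -
  have "\<not> i < j"
    if "((\<lambda>t. t ^ i * f t) \<longlongrightarrow> a) (at 0)" "((\<lambda>t. t ^ j * f t) \<longlongrightarrow> b) (at 0)" "b \<noteq> 0"
    for i j and a b :: complex
  proof
    assume "i < j"
    have "((\<lambda>t. t ^ (j - i) * (t ^ i * f t)) \<longlongrightarrow> 0 ^ (j - i) * a) (at 0)"
      by (intro tendsto_intros that)
    moreover have "(\<lambda>t. t ^ (j - i) * (t ^ i * f t)) = (\<lambda>t. t ^ j * f t)"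
      using \<open>i < j\<close> by (simp flip: mult.assoc power_add)
    ultimately have "b = 0 ^ (j - i) * a"
      using that(2) tendsto_unique[of "at (0 :: complex)"] by (metis trivial_limit_at)
    then show False using \<open>i < j\<close> that(3) by simp
  qed
  from this[OF assms(1,3,4)] this[OF assms(3,1,2)] show ?thesis by simp
qed

text \<open>The two cosines grow like \<open>1 / t\<close> and \<open>1 / t ^ k\<close>, and the
  faster one dominates. For \<open>k = 1\<close> they grow alike, and \<open>a \<noteq> b\<close>
  keeps the leading terms from cancelling.\<close>

lemma factor_growth:
  fixes a b :: complex
  assumes "a \<noteq> 0" "b \<noteq> 0" "a \<noteq> b"
  obtains L where "L \<noteq> 0"
    "((\<lambda>t. t ^ max 1 k * ((a / t + t / a) / 2 - (b / t ^ k + t ^ k / b) / 2)) \<longlongrightarrow> L) (at 0)"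
proof -
  have nz: "\<forall>\<^sub>F t in at (0 :: complex). t \<noteq> 0" by (rule eventually_neq_at_within)
  consider "k = 0" | "k = 1" | j where "k = Suc (Suc j)"
    by (metis One_nat_def not0_implies_Suc)
  then show thesis
  proof cases
    case 1
    have "((\<lambda>t. (a + t ^ 2 / a - t * (b + 1 / b)) / 2) \<longlongrightarrow> (a + 0 ^ 2 / a - 0 * (b + 1 / b)) / 2) (at 0)"
      by (intro tendsto_intros) (auto simp: assms)
    then show ?thesis
      by (intro that[of "a / 2"], use assms in simp)
        (rule Lim_transform_eventually[rotated], rule eventually_mono[OF nz],
          auto simp: 1 field_simps power2_eq_square)
  next
    case 2
    have "((\<lambda>t. (a + t ^ 2 / a - b - t ^ 2 / b) / 2) \<longlongrightarrow> (a + 0 ^ 2 / a - b - 0 ^ 2 / b) / 2) (at 0)"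
      by (intro tendsto_intros) (auto simp: assms)
    then show ?thesis
      by (intro that[of "(a - b) / 2"], use assms in simp)
        (rule Lim_transform_eventually[rotated], rule eventually_mono[OF nz],
          auto simp: 2 field_simps power2_eq_square)
  next
    case 3
    have "((\<lambda>t. (a * t ^ Suc j + t ^ Suc (Suc (Suc j)) / a - b - t ^ k * t ^ k / b) / 2) \<longlongrightarrow>
        (a * 0 ^ Suc j + 0 ^ Suc (Suc (Suc j)) / a - b - 0 ^ k * 0 ^ k / b) / 2) (at 0)"
      by (intro tendsto_intros) (auto simp: assms)
    then show ?thesis
      by (intro that[of "- b / 2"], use assms in simp)
        (rule Lim_transform_eventually[rotated], rule eventually_mono[OF nz],
          auto simp: 3 field_simps)
  qed
qed

lemma exp_signed_sum:
  fixes x :: "nat \<Rightarrow> complex"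
  shows "exp (\<i> * signed_sum m A x) =
    (\<Prod>i\<le>m. if i \<in> A then inverse (exp (\<i> * x i)) else exp (\<i> * x i))"
  unfolding signed_sum_def sum_distrib_left exp_sum[OF finite_atMost]
  by (rule prod.cong) (auto simp: exp_minus)

lemma cos_eq_exp: "cos z = (exp (\<i> * z) + inverse (exp (\<i> * z))) / 2"
  by (simp add: cos_exp_eq exp_minus)

text \<open>With \<open>exp (\<i> * x i) = a i / t\<close>, the exponential of a signed sum is
  \<open>b A\<close> times a power of \<open>t\<close> given by the sum of the signs. The norm
  bounds keep \<open>a (Suc m)\<close> away from each \<open>b A\<close> and its inverse, so no
  leading terms cancel.\<close>

lemma cyclefun_growth:
  assumes F: "cyclefun m F"
    and a: "\<And>i. i \<le> m \<Longrightarrow> norm (a i) \<in> {2..4}" "norm (a (Suc m)) > 4 ^ Suc m"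
  obtains L where "L \<noteq> 0"
    "((\<lambda>t. t ^ (\<Sum>A \<in> Pow {1..m}. max 1 (nat \<bar>int (Suc m) - 2 * int (card A)\<bar>)) *
        F (\<lambda>i. (a i / t + t / a i) / 2)) \<longlongrightarrow> L) (at 0)"
proof -
  define e where "e A = max 1 (nat \<bar>int (Suc m) - 2 * int (card A)\<bar>)" for A :: "nat set"
  define y where "y t i = (a i / t + t / a i) / 2" for t i
  define b where "b A = (\<Prod>i\<le>m. if i \<in> A then inverse (a i) else a i)" for A
  have a0: "a i \<noteq> 0" if "i \<le> Suc m" for i
    using a(1)[of i] a(2) that by (cases "i \<le> m") (auto simp: le_Suc_eq)
  have b0: "b A \<noteq> 0" for A using a0 by (auto simp: b_def)
  have bound: "norm (b A) \<le> 4 ^ Suc m" "norm (inverse (b A)) \<le> 4 ^ Suc m" for A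
  proof -
    have "inverse (norm (a i)) \<le> 1" if "i \<le> m" for i
      using a(1)[OF that] by (intro inverse_le_1_iff[THEN iffD2]) auto
    then have le: "norm (if i \<in> A then inverse (a i) else a i) \<le> 4"
      "norm (inverse (if i \<in> A then inverse (a i) else a i)) \<le> 4" if "i \<le> m" for i
      using a(1)[OF that] that by (force simp: norm_inverse)+
    have "norm (b A) \<le> (\<Prod>i\<le>m. 4)"
      unfolding b_def prod_norm[symmetric] by (intro prod_mono) (use le in auto)
    then show "norm (b A) \<le> 4 ^ Suc m" by simp
    have "norm (inverse (b A)) \<le> (\<Prod>i\<le>m. 4)"
      unfolding b_def prod_inversef[symmetric] comp_def prod_norm[symmetric]
      by (intro prod_mono) (use le in auto)
    then show "norm (inverse (b A)) \<le> 4 ^ Suc m" by simp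
  qed
  have ab: "a (Suc m) \<noteq> b A" "a (Suc m) \<noteq> inverse (b A)" for A
    using bound[of A] a(2) by auto
  \<comment> \<open>The branch of the logarithm is immaterial, as only exponentials of these angles
    enter.\<close>
  define x where "x t i = - \<i> * Ln (a i / t)" for t i
  have x: "exp (\<i> * x t i) = a i / t" if "t \<noteq> 0" "i \<le> Suc m" for t i
    using a0[OF that(2)] that(1) by (simp add: x_def)
  have cosx: "y t i = cos (x t i)" if "t \<noteq> 0" "i \<le> Suc m" for t i
    unfolding cos_eq_exp x[OF that] by (simp add: y_def)
  have cos_sum: "cos (signed_sum m A (x t)) =
      (b A / t ^ (Suc m - card A) * t ^ card A + t ^ (Suc m - card A) / (b A * t ^ card A)) / 2"
    if "t \<noteq> 0" "A \<in> Pow {1..m}" for A t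
  proof -
    have "exp (\<i> * signed_sum m A (x t)) =
        (\<Prod>i\<le>m. (if i \<in> A then inverse (a i) else a i) * (if i \<in> A then t else inverse t))"
      unfolding exp_signed_sum by (rule prod.cong) (auto simp: x[OF that(1)] divide_inverse)
    also have "\<dots> = b A * (\<Prod>i\<le>m. if i \<in> A then t else inverse t)"
      by (simp add: b_def prod.distrib)
    also have "(\<Prod>i\<le>m. if i \<in> A then t else inverse t) = t ^ card A * inverse t ^ (Suc m - card A)"
    proof -
      have sub: "A \<subseteq> {..m}" using that(2) by auto
      then have "{..m} \<inter> A = A" "card ({..m} \<inter> - A) = Suc m - card A"
        by (auto simp: card_Diff_subset finite_subset simp flip: Diff_eq)
      then show ?thesis by (simp add: prod.If_cases)
    qed
    finally have "exp (\<i> * signed_sum m A (x t)) = b A / t ^ (Suc m - card A) * t ^ card A"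
      by (simp add: field_simps)
    then show ?thesis unfolding cos_eq_exp by (simp add: field_simps)
  qed
  have "\<exists>L. L \<noteq> 0 \<and>
      ((\<lambda>t. t ^ e A * (y t (Suc m) - cos (signed_sum m A (x t)))) \<longlongrightarrow> L) (at 0)"
    if A: "A \<in> Pow {1..m}" for A
  proof -
    have card: "card A \<le> m" using card_mono[of "{1..m}" A] A by auto
    \<comment> \<open>The cosine is even: if minus signs prevail, \<open>b A\<close> is replaced by
      its inverse and the exponent \<open>k\<close> stays a natural number.\<close>
    obtain k b' where k: "e A = max 1 k" "b' \<noteq> 0" "a (Suc m) \<noteq> b'"
      and cos_k: "\<And>t. t \<noteq> 0 \<Longrightarrow> cos (signed_sum m A (x t)) = (b' / t ^ k + t ^ k / b') / 2"
    proof (cases "2 * card A \<le> Suc m")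
      case True
      define k where "k = Suc m - 2 * card A"
      have k: "Suc m - card A = k + card A" using True by (simp add: k_def)
      show thesis
      proof (rule that[of k "b A"])
        show "e A = max 1 k" using True by (simp add: e_def k_def nat_diff_distrib' nat_mult_distrib of_nat_diff)
        show "cos (signed_sum m A (x t)) = (b A / t ^ k + t ^ k / b A) / 2" if "t \<noteq> 0" for t
          unfolding cos_sum[OF that A] k power_add using that by simp
      qed (use ab b0 in auto)
    next
      case False
      define k where "k = 2 * card A - Suc m"
      have k: "card A = k + (Suc m - card A)" using False card by (simp add: k_def)
      show thesis
      proof (rule that[of k "inverse (b A)"])
        show "e A = max 1 k" using False by (simp add: e_def k_def)
        show "cos (signed_sum m A (x t)) = (inverse (b A) / t ^ k + t ^ k / inverse (b A)) / 2" if "t \<noteq> 0" for t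
        proof -
          have "t ^ card A = t ^ k * t ^ (Suc m - card A)"
            by (subst k) (rule power_add)
          then show ?thesis
            unfolding cos_sum[OF that A] using that b0[of A] by (simp add: field_simps)
        qed
      qed (use ab b0 in auto)
    qed
    obtain L where L: "L \<noteq> 0" "((\<lambda>t. t ^ max 1 k *
        ((a (Suc m) / t + t / a (Suc m)) / 2 - (b' / t ^ k + t ^ k / b') / 2)) \<longlongrightarrow> L) (at 0)"
      using factor_growth[OF a0[OF order_refl] k(2,3)] by blast
    have "((\<lambda>t. t ^ e A * (y t (Suc m) - cos (signed_sum m A (x t)))) \<longlongrightarrow> L) (at 0)"
    proof (rule Lim_transform_eventually[OF L(2)])
      show "\<forall>\<^sub>F t in at 0. t ^ max 1 k *
          ((a (Suc m) / t + t / a (Suc m)) / 2 - (b' / t ^ k + t ^ k / b') / 2) =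
          t ^ e A * (y t (Suc m) - cos (signed_sum m A (x t)))"
        using eventually_neq_at_within[of "0 :: complex" 0 UNIV]
        by (rule eventually_mono) (simp add: k(1) y_def cos_k)
    qed
    then show ?thesis using L(1) by blast
  qed
  then obtain L where L: "\<And>A. A \<in> Pow {1..m} \<Longrightarrow> L A \<noteq> 0"
    "\<And>A. A \<in> Pow {1..m} \<Longrightarrow>
      ((\<lambda>t. t ^ e A * (y t (Suc m) - cos (signed_sum m A (x t)))) \<longlongrightarrow> L A) (at 0)"
    by metis
  have "((\<lambda>t. \<Prod>A \<in> Pow {1..m}. t ^ e A * (y t (Suc m) - cos (signed_sum m A (x t)))) \<longlongrightarrow>
      (\<Prod>A \<in> Pow {1..m}. L A)) (at 0)"
    by (intro tendsto_prod L)
  then have "((\<lambda>t. t ^ (\<Sum>A \<in> Pow {1..m}. e A) * F (y t)) \<longlongrightarrow> (\<Prod>A \<in> Pow {1..m}. L A)) (at 0)"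
  proof (rule Lim_transform_eventually)
    show "\<forall>\<^sub>F t in at 0. (\<Prod>A \<in> Pow {1..m}. t ^ e A * (y t (Suc m) - cos (signed_sum m A (x t)))) =
        t ^ (\<Sum>A \<in> Pow {1..m}. e A) * F (y t)"
      using eventually_neq_at_within[of "0 :: complex" 0 UNIV]
    proof (rule eventually_mono)
      fix t :: complex assume "t \<noteq> 0"
      then have "F (y t) = (\<Prod>A \<in> Pow {1..m}. y t (Suc m) - cos (signed_sum m A (x t)))"
        by (intro cyclefun_eq[OF F] cosx) auto
      then show "(\<Prod>A \<in> Pow {1..m}. t ^ e A * (y t (Suc m) - cos (signed_sum m A (x t)))) =
          t ^ (\<Sum>A \<in> Pow {1..m}. e A) * F (y t)"
        by (simp only: prod.distrib power_sum)
    qed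
  qed
  moreover have "(\<Prod>A \<in> Pow {1..m}. L A) \<noteq> 0" using L(1) by auto
  ultimately show thesis using that unfolding e_def y_def by blast
qed

subsection \<open>The sum of the exponents\<close>

lemma sum_Pow_card:
  fixes f :: "nat \<Rightarrow> 'a::comm_semiring_1"
  assumes "finite S"
  shows "(\<Sum>A \<in> Pow S. f (card A)) = (\<Sum>k\<le>card S. of_nat (card S choose k) * f k)"
proof -
  have "(\<Sum>A \<in> Pow S. f (card A)) = (\<Sum>k\<le>card S. \<Sum>A \<in> {A \<in> Pow S. card A = k}. f (card A))"
    using assms by (intro sum.group[symmetric]) (auto intro: card_mono)
  also have "\<dots> = (\<Sum>k\<le>card S. of_nat (card S choose k) * f k)"
    using assms by (intro sum.cong refl) (simp add: n_subsets)
  finally show ?thesis .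
qed

lemma sum_choose_Suc:
  fixes f :: "nat \<Rightarrow> real"
  shows "(\<Sum>k\<le>Suc n. real (Suc n choose k) * f k) = (\<Sum>k\<le>n. real (n choose k) * (f k + f (Suc k)))"
proof -
  have "(\<Sum>k\<le>Suc n. real (Suc n choose k) * f k) =
      f 0 + (\<Sum>k\<le>n. real (n choose Suc k) * f (Suc k)) + (\<Sum>k\<le>n. real (n choose k) * f (Suc k))"
    by (subst sum.atMost_Suc_shift) (simp add: distrib_right sum.distrib)
  also have "f 0 + (\<Sum>k\<le>n. real (n choose Suc k) * f (Suc k)) = (\<Sum>k\<le>Suc n. real (n choose k) * f k)"
    by (subst sum.atMost_Suc_shift) simp
  also have "\<dots> = (\<Sum>k\<le>n. real (n choose k) * f k)" by simp
  finally show ?thesis by (simp add: distrib_left sum.distrib)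
qed

text \<open>By the absorption identities the term at \<open>j\<close> is \<open>Suc n\<close> times
  the difference of \<open>n choose j\<close> and \<open>n choose (j - 1)\<close>, the latter read
  as 0 for \<open>j = 0\<close>.\<close>

lemma sum_choose_telescope:
  "(\<Sum>j\<le>h. real (Suc n choose j) * (real (Suc n) - 2 * real j)) = real (Suc n) * real (n choose h)"
proof (induction h)
  case (Suc h)
  have "real (Suc h) * real (Suc n choose Suc h) = real (Suc n) * real (n choose h)"
    using Suc_times_binomial_eq[of n h] by (simp only: of_nat_mult[symmetric] mult.commute)
  moreover have "real (Suc n choose Suc h) = real (n choose h) + real (n choose Suc h)" by simp
  ultimately have "real (Suc n choose Suc h) * (real (Suc n) - 2 * real (Suc h)) =
      real (Suc n) * real (n choose Suc h) - real (Suc n) * real (n choose h)"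
    by (simp only: algebra_simps)
  then show ?case using Suc.IH by simp
qed simp

text \<open>The signed terms are nonnegative up to \<open>n div 2\<close> and nonpositive
  afterwards, and their total is 0 because \<open>n choose Suc n\<close> vanishes. So the absolute
  values add up to twice the partial sum.\<close>

lemma sum_choose_abs:
  "(\<Sum>j\<le>Suc n. real (Suc n choose j) * \<bar>real (Suc n) - 2 * real j\<bar>) =
    2 * real (Suc n) * real (n choose (n div 2))"
proof -
  let ?f = "\<lambda>j. real (Suc n choose j) * (real (Suc n) - 2 * real j)"
  let ?c = "\<lambda>j. if j \<le> n div 2 then ?f j else 0"
  have "real (Suc n choose j) * \<bar>real (Suc n) - 2 * real j\<bar> = 2 * ?c j - ?f j" for j
  proof (cases "j \<le> n div 2")
    case True
    then have "2 * real j \<le> real (Suc n)" by linarith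
    with True show ?thesis by simp
  next
    case False
    then have "2 * real j \<ge> real (Suc n)" by linarith
    with False show ?thesis by (simp add: algebra_simps)
  qed
  then have "(\<Sum>j\<le>Suc n. real (Suc n choose j) * \<bar>real (Suc n) - 2 * real j\<bar>) =
      2 * (\<Sum>j\<le>Suc n. ?c j) - (\<Sum>j\<le>Suc n. ?f j)"
    by (simp only: sum_subtractf sum_distrib_left)
  also have "(\<Sum>j\<le>Suc n. ?f j) = 0"
    unfolding sum_choose_telescope by simp
  also have "(\<Sum>j\<le>Suc n. ?c j) = (\<Sum>j\<le>n div 2. ?f j)"
    by (rule sum.mono_neutral_cong_right) auto
  also have "\<dots> = real (Suc n) * real (n choose (n div 2))"
    by (rule sum_choose_telescope)
  finally show ?thesis by simp
qed

text \<open>Since \<open>max 1 \<bar>k\<bar> = (\<bar>k + 1\<bar> + \<bar>k - 1\<bar>) / 2\<close> for integers \<open>k\<close>, applying Pascal's rule twice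
  turns the sum over the \<open>m\<close> free signs into one over all \<open>m + 2\<close> signs.\<close>

lemma sum_growth_exponents:
  "real (\<Sum>A \<in> Pow {1..m}. max 1 (nat \<bar>int (Suc m) - 2 * int (card A)\<bar>)) =
    real (Suc (Suc m)) / 2 * real (Suc m choose (Suc m div 2))"
proof -
  define g where "g k = max 1 \<bar>real (Suc m) - 2 * real k\<bar>" for k
  have "real (max 1 (nat \<bar>int (Suc m) - 2 * int k\<bar>)) = g k" for k
    unfolding g_def by linarith
  then have "real (\<Sum>A \<in> Pow {1..m}. max 1 (nat \<bar>int (Suc m) - 2 * int (card A)\<bar>)) =
      (\<Sum>A \<in> Pow {1..m}. g (card A))"
    by (simp only: of_nat_sum)
  also have "\<dots> = (\<Sum>k\<le>m. real (m choose k) * g k)"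
    using sum_Pow_card[of "{1..m}" g] by simp
  finally have lhs: "real (\<Sum>A \<in> Pow {1..m}. max 1 (nat \<bar>int (Suc m) - 2 * int (card A)\<bar>)) =
      (\<Sum>k\<le>m. real (m choose k) * g k)" .
  have "\<bar>real (Suc (Suc m)) - 2 * real k\<bar> + \<bar>real (Suc (Suc m)) - 2 * real (Suc k)\<bar> = 2 * g k" for k
  proof -
    \<comment> \<open>In the middle case both absolute values on the left are 1; there the bound by
      1 in \<open>g\<close> takes effect.\<close>
    consider "2 * k \<le> m" | "2 * k = Suc m" | "2 * k \<ge> Suc (Suc m)" by linarith
    then show ?thesis
    proof cases
      case 1
      then have "2 * real k \<le> real m" by linarith
      then show ?thesis by (simp add: g_def)
    next
      case 2
      then have "2 * real k = real m + 1" by linarith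
      then show ?thesis by (simp add: g_def)
    next
      case 3
      then have "2 * real k \<ge> real m + 2" by linarith
      then show ?thesis by (simp add: g_def)
    qed
  qed
  then have "(\<Sum>k\<le>Suc (Suc m). real (Suc (Suc m) choose k) * \<bar>real (Suc (Suc m)) - 2 * real k\<bar>) =
      2 * (\<Sum>k\<le>Suc m. real (Suc m choose k) * g k)"
    unfolding sum_choose_Suc[of "Suc m"] sum_distrib_left by (simp only: mult.left_commute)
  also have "\<dots> = 2 * ((\<Sum>k\<le>m. real (m choose k) * g k) + (\<Sum>k\<le>m. real (m choose k) * g (Suc k)))"
    unfolding sum_choose_Suc[of m] by (simp only: distrib_left sum.distrib)
  \<comment> \<open>Flipping all signs, \<open>k\<close> to \<open>m - k\<close>, changes only the
    sign inside the absolute value.\<close>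
  also have "(\<Sum>k\<le>m. real (m choose k) * g (Suc k)) = (\<Sum>k\<le>m. real (m choose k) * g k)"
  proof (rule sum.reindex_bij_witness[of _ "\<lambda>k. m - k" "\<lambda>k. m - k"])
    fix k assume "k \<in> {..m}"
    moreover from this have "g (m - k) = g (Suc k)" unfolding g_def by (simp add: of_nat_diff)
    ultimately show "real (m choose (m - k)) * g (m - k) = real (m choose k) * g (Suc k)"
      by (simp add: binomial_symmetric[symmetric])
  qed auto
  finally have "2 * real (Suc (Suc m)) * real (Suc m choose (Suc m div 2)) =
      2 * ((\<Sum>k\<le>m. real (m choose k) * g k) + (\<Sum>k\<le>m. real (m choose k) * g k))"
    unfolding sum_choose_abs[of "Suc m"] .
  moreover have "s = N / 2 * C" if "2 * N * C = 2 * (s + s)" for s N C :: real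
    using that by (simp add: mult.commute)
  ultimately show ?thesis unfolding lhs by blast
qed

subsection \<open>The degree\<close>

theorem proposition2p6:
  fixes n :: nat and \<Gamma> :: cpoly
  assumes "n \<ge> 2"
    and "is_cycle_polynomial n \<Gamma>"
  shows "real (total_degree \<Gamma>)
    = real n / 2 * real ((n - 1) choose nat \<lfloor>1 / 2 * (real n - 1)\<rfloor>)"
proof -
  obtain m where n: "n = Suc (Suc m)" using assms(1) by (metis add_2_eq_Suc le_Suc_ex)
  let ?I = "vanishing_ideal n (cosine_variety (cycle_matrix n))"
  have \<Gamma>: "\<Gamma> \<in> polys_in n" and I: "?I = {q * \<Gamma> | q. q \<in> polys_in n}"
    using assms(2) by (auto simp: is_cycle_polynomial_def)
  have "(1 :: cpoly) \<in> polys_in n" by (simp add: polys_in_def)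
  then have "1 * \<Gamma> \<in> ?I" unfolding I by blast
  then have \<Gamma>_vanish: "peval \<Gamma> (\<lambda>i. cos (x i)) = 0" if "(\<Sum>i\<le>Suc m. x i) = 0" for x
    using \<Gamma> that unfolding n by (simp add: mem_vanishing_ideal)
  obtain F where F: "cyclefun m F" using cyclefun_exists by blast
  then have "polyfun n F" by (simp add: cyclefun_def n)
  then obtain P where P: "P \<in> polys_in n" "peval P = F" by (rule polyfun_peval)
  \<comment> \<open>On the variety the factor without minus signs vanishes, since the last angle is
    minus the sum of the others.\<close>
  have "F (\<lambda>i. cos (x i)) = 0" if "(\<Sum>i\<le>Suc m. x i) = 0" for x
  proof -
    have "x (Suc m) = - signed_sum m {} x"
      using that by (simp add: signed_sum_def add_eq_0_iff2 add.commute)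
    then have "\<exists>A \<in> Pow {1..m}. cos (x (Suc m)) - cos (signed_sum m A x) = 0"
      by (intro bexI[of _ "{}"]) auto
    then show ?thesis by (subst cyclefun_eq[OF F, of _ x]) (auto intro: prod_zero)
  qed
  then have "P \<in> ?I" using P unfolding n by (simp add: mem_vanishing_ideal)
  then obtain q' where q': "q' \<in> polys_in n" "P = q' * \<Gamma>" unfolding I by blast
  obtain f where "polyfun n f" "\<And>c. peval \<Gamma> c = f c * F c"
    using cyclefun_dvd[OF F polyfun_of_peval[OF \<Gamma>[unfolded n]] \<Gamma>_vanish] unfolding n by blast
  then obtain q where q: "q \<in> polys_in n" "\<And>c. peval \<Gamma> c = peval q c * F c"
    by (metis polyfun_peval)
  define E where "E = (\<Sum>A \<in> Pow {1..m}. max 1 (nat \<bar>int (Suc m) - 2 * int (card A)\<bar>))"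
  let ?y = "\<lambda>a t i. (a i / t + t / a i) / 2 :: complex"
  have F_eq: "F c = peval q' c * peval \<Gamma> c" for c
    using q'(2) P(2) by (metis peval_mult)
  \<comment> \<open>A concrete admissible choice of \<open>a\<close>, used to see that
    \<open>F\<close> is not identically 0.\<close>
  obtain L where L: "L \<noteq> 0" "((\<lambda>t. t ^ E * F (?y (\<lambda>i. if i \<le> m then 2 else 4 ^ Suc (Suc m)) t)) \<longlongrightarrow> L) (at 0)"
    by (rule cyclefun_growth[OF F, of "\<lambda>i. if i \<le> m then 2 else 4 ^ Suc (Suc m)"])
      (auto simp: E_def norm_power)
  have "\<exists>c. F c \<noteq> 0"
  proof (rule ccontr)
    assume "\<nexists>c. F c \<noteq> 0"
    with L(2) have "((\<lambda>t. 0) \<longlongrightarrow> L) (at (0 :: complex))" by simp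
    with L(1) show False using LIM_const_eq by metis
  qed
  then obtain c where "F c \<noteq> 0" ..
  then have nz: "q' \<noteq> 0" "\<Gamma> \<noteq> 0" using F_eq[of c] by (auto simp: peval_zero)
  then have "q \<noteq> 0" using q(2) peval_nonzero[OF \<Gamma>] by (metis mult_zero_left peval_zero)
  obtain h u where h: "polyfun n h" "h u \<noteq> 0"
    "\<And>y a. (\<And>i. i < n \<Longrightarrow> ((\<lambda>t. t * y t i) \<longlongrightarrow> a i) (at 0)) \<Longrightarrow>
      ((\<lambda>t. t ^ total_degree \<Gamma> * peval \<Gamma> (y t)) \<longlongrightarrow> h a) (at 0)"
    using peval_leading_form[OF \<Gamma> nz(2)] by blast
  obtain h1 u1 where h1: "polyfun n h1" "h1 u1 \<noteq> 0"
    "\<And>y a. (\<And>i. i < n \<Longrightarrow> ((\<lambda>t. t * y t i) \<longlongrightarrow> a i) (at 0)) \<Longrightarrow>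
      ((\<lambda>t. t ^ total_degree q * peval q (y t)) \<longlongrightarrow> h1 a) (at 0)"
    using peval_leading_form[OF q(1) \<open>q \<noteq> 0\<close>] by blast
  obtain h2 u2 where h2: "polyfun n h2" "h2 u2 \<noteq> 0"
    "\<And>y a. (\<And>i. i < n \<Longrightarrow> ((\<lambda>t. t * y t i) \<longlongrightarrow> a i) (at 0)) \<Longrightarrow>
      ((\<lambda>t. t ^ total_degree q' * peval q' (y t)) \<longlongrightarrow> h2 a) (at 0)"
    using peval_leading_form[OF q'(1) nz(1)] by blast
  obtain v where "h1 v * h2 v \<noteq> 0"
    using polyfun_common_nonzero[OF h1(1,2) h2(1,2)] by blast
  then obtain v where "h v * (h1 v * h2 v) \<noteq> 0"
    using polyfun_common_nonzero[OF h(1,2) polyfun_mult[OF h1(1) h2(1)]] by blast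
  moreover have "polyfun n (\<lambda>v. h v * (h1 v * h2 v))"
    by (intro polyfun_mult h h1 h2)
  \<comment> \<open>The curve satisfies \<open>t * y t i \<longlongrightarrow> a i / 2\<close>, so
    the leading forms are evaluated at \<open>v\<close> with \<open>a i = 2 * v i\<close>. These
    sets put \<open>a\<close> into the range of the growth estimate.\<close>
  moreover define S where "S i = (of_real ` (if i \<le> m then {1..2} else {4 ^ Suc m<..}) :: complex set)" for i
  have "infinite (S i)" for i
    by (simp add: S_def finite_image_iff inj_on_def infinite_Ioi)
  ultimately obtain v where v: "\<And>i. i < n \<Longrightarrow> v i \<in> S i" "h v * (h1 v * h2 v) \<noteq> 0"
    using polyfun_nonzero_on_product[of n "\<lambda>v. h v * (h1 v * h2 v)" _ S] by blast
  define a where "a i = 2 * v i" for i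
  have a: "norm (a i) \<in> {2..4}" if "i \<le> m" for i
    using v(1)[of i] that n by (auto simp: S_def a_def norm_mult)
  have a': "norm (a (Suc m)) > 4 ^ Suc m"
    using v(1)[of "Suc m"] n by (auto simp: S_def a_def norm_mult)
  have lim: "((\<lambda>t. t * ?y a t i) \<longlongrightarrow> v i) (at 0)" if "i < n" for i
  proof -
    have "a i \<noteq> 0" using a[of i] a' that n by (cases "i \<le> m") (auto simp: le_Suc_eq less_Suc_eq)
    then have "((\<lambda>t. (a i + t ^ 2 / a i) / 2) \<longlongrightarrow> (a i + 0 ^ 2 / a i) / 2) (at 0)"
      by (intro tendsto_intros) auto
    then have "((\<lambda>t. (a i + t ^ 2 / a i) / 2) \<longlongrightarrow> v i) (at 0)" by (simp add: a_def)
    then show ?thesis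
    proof (rule Lim_transform_eventually)
      show "\<forall>\<^sub>F t in at 0. (a i + t ^ 2 / a i) / 2 = t * ?y a t i"
        using eventually_neq_at_within[of "0 :: complex" 0 UNIV]
        by (rule eventually_mono) (simp add: distrib_left power2_eq_square)
    qed
  qed
  obtain L where L: "L \<noteq> 0" "((\<lambda>t. t ^ E * F (?y a t)) \<longlongrightarrow> L) (at 0)"
    unfolding E_def by (rule cyclefun_growth[where a = a, OF F a a'])
  note lims = h(3)[OF lim] h1(3)[OF lim] h2(3)[OF lim]
  \<comment> \<open>Orders of growth add up under multiplication. Together with the reverse
    divisibility below, this forces both cofactors to have degree 0.\<close>
  have "total_degree \<Gamma> = total_degree q + E"
  proof (rule growth_exponent_unique[OF lims(1)])
    show "((\<lambda>t. t ^ (total_degree q + E) * peval \<Gamma> (?y a t)) \<longlongrightarrow> h1 v * L) (at 0)"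
      using tendsto_mult[OF lims(2) L(2)] by (simp add: q(2) power_add mult_ac)
  qed (use v(2) L(1) in auto)
  moreover have "E = total_degree q' + total_degree \<Gamma>"
  proof (rule growth_exponent_unique[OF L(2,1)])
    show "((\<lambda>t. t ^ (total_degree q' + total_degree \<Gamma>) * F (?y a t)) \<longlongrightarrow> h2 v * h v) (at 0)"
      using tendsto_mult[OF lims(3,1)] by (simp add: F_eq power_add mult_ac)
  qed (use v(2) in auto)
  ultimately have "total_degree \<Gamma> = E" by simp
  moreover have "nat \<lfloor>1 / 2 * (real n - 1)\<rfloor> = Suc m div 2"
  proof -
    have "1 / 2 * (real n - 1) = real (Suc m) / real 2" by (simp add: n)
    then show ?thesis by (simp only: floor_divide_of_nat_eq nat_int)
  qed
  ultimately show ?thesis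
    using sum_growth_exponents[of m] by (simp add: E_def n)
qed

end
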